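(* Let $h\in\mathcal{O}_M(\mathbb{R})$, and let $M_h$, $M_hf=hf$, denote the multiplication operator acting either on $E=\mathcal{S}(\mathbb{R})$ or on $E=\mathcal{O}_M(\mathbb{R})$. In both cases the spectra of $M_h\in\mathcal{L}(E)$ satisfy \[ (\overline{\mathrm{Im}\,h})^c\subseteq\rho(M_h)\subseteq(\mathrm{Im}\,h)^c,\qquad \rho^*(M_h)=(\overline{\mathrm{Im}\,h})^c, \] \[ \mathrm{Im}\,h\subseteq\sigma(M_h)\subseteq\overline{\mathrm{Im}\,h},\qquad \sigma^*(M_h)=\overline{\mathrm{Im}\,h}, \] \[ \sigma_p(M_h)=\{\lambda\in\mathbb{C}\colon h^{-1}(\lambda)\text{ has non-empty interior}\}\subseteq\mathrm{Im}\,h . \] Here $\mathrm{Im}\,h=h(\mathbb{R})\subseteq\mathbb{C}$, $A^c=\mathbb{C}\setminus A$, and $h^{-1}(\lambda)=\{x\in\mathbb{R}\colon h(x)=\lambda\}$.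
   Context: All functions are complex-valued. $\mathcal{S}(\mathbb{R})$ is the Schwartz space of $f\in C^\infty(\mathbb{R})$ with $\|f\|_n:=\sup_{x\in\mathbb{R}}\sup_{0\le i\le n}(1+x^2)^n|f^{(i)}(x)|<\infty$ for all $n\in\mathbb{N}_0$, a Fréchet space with these norms. $\mathcal{O}_M(\mathbb{R})$ is the space of all $f\in C^\infty(\mathbb{R})$ such that for every $m\in\mathbb{N}$ there is $n\in\mathbb{N}$ with $|f|_{m,n}:=\sup_{x\in\mathbb{R}}\sup_{0\le i\le m}(1+x^2)^{-n}|f^{(i)}(x)|<\infty$. Its locally convex topology is the one of $\mathrm{proj}_m\,\mathrm{ind}_n$ of the spaces normed by $|\cdot|_{m,n}$; it is generated by the norms $p_{m,v}(f)=\sup_{x\in\mathbb{R}}\sup_{0\le i\le m}|v(x)||f^{(i)}(x)|$, $m\in\mathbb{N}$, $v\in\mathcal{S}(\mathbb{R})$. For $h\in\mathcal{O}_M(\mathbb{R})$, $M_h$ maps $\mathcal{S}(\mathbb{R})$ continuously into itself and $\mathcal{O}_M(\mathbb{R})$ continuously into itself. For a locally convex Hausdorff space $E$, $\mathcal{L}(E)$ is the space of continuous linear operators on $E$. For $T\in\mathcal{L}(E)$: $\rho(T)$ is the set of $\lambda\in\mathbb{C}$ such that $\lambda I-T$ is bijective with $R(\lambda,T):=(\lambda I-T)^{-1}\in\mathcal{L}(E)$; $\sigma(T)=\mathbb{C}\setminus\rho(T)$; $\sigma_p(T)=\{\lambda\in\mathbb{C}\colon\lambda I-T\text{ is not injective}\}$;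 $\rho^*(T)$ is the set of $\lambda\in\mathbb{C}$ for which there is $\delta>0$ such that $B(\lambda,\delta)=\{\mu\in\mathbb{C}\colon|\mu-\lambda|<\delta\}\subseteq\rho(T)$ and $\{R(\mu,T)\colon\mu\in B(\lambda,\delta)\}$ is equicontinuous in $\mathcal{L}(E)$; $\sigma^*(T)=\mathbb{C}\setminus\rho^*(T)$. *)

theory Defs
  imports "HOL-Analysis.Analysis"
begin

section \<open>Locally convex topologies on spaces of complex-valued functions\<close>

text \<open>
  A space of functions is a carrier set of type \<^typ>\<open>('x \<Rightarrow> complex) set\<close> with the pointwise
  operations; a topological space of functions is an abstract topology whose
  \<^const>\<open>topspace\<close> is the carrier. Operators are total functions of which only the values on
  the carrier matter.
\<close>

definition seminorm_on :: "('x \<Rightarrow> complex) set \<Rightarrow> (('x \<Rightarrow> complex) \<Rightarrow> real) \<Rightarrow> bool" where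
  "seminorm_on V q \<longleftrightarrow>
     (\<forall>f\<in>V. 0 \<le> q f) \<and>
     (\<forall>f\<in>V. \<forall>c. q (\<lambda>x. c * f x) = cmod c * q f) \<and>
     (\<forall>f\<in>V. \<forall>g\<in>V. q (\<lambda>x. f x + g x) \<le> q f + q g)"

definition seminorm_topology ::
    "('x \<Rightarrow> complex) set \<Rightarrow> (('x \<Rightarrow> complex) \<Rightarrow> real) set \<Rightarrow> ('x \<Rightarrow> complex) topology" where
  "seminorm_topology V P =
     topology (\<lambda>U. U \<subseteq> V \<and>
       (\<forall>f\<in>U. \<exists>F \<epsilon>. finite F \<and> F \<subseteq> P \<and> \<epsilon> > 0 \<and>
          {g\<in>V. \<forall>p\<in>F. p (\<lambda>x. g x - f x) < \<epsilon>} \<subseteq> U))"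

lemma openin_seminorm_topology:
  "openin (seminorm_topology V P) U \<longleftrightarrow>
     U \<subseteq> V \<and>
     (\<forall>f\<in>U. \<exists>F \<epsilon>. finite F \<and> F \<subseteq> P \<and> \<epsilon> > 0 \<and>
        {g\<in>V. \<forall>p\<in>F. p (\<lambda>x. g x - f x) < \<epsilon>} \<subseteq> U)"
proof -
  let ?nb = "\<lambda>f F \<epsilon>. {g\<in>V. \<forall>p\<in>F. p (\<lambda>x. g x - f x) < (\<epsilon>::real)}"
  let ?L = "\<lambda>U. U \<subseteq> V \<and> (\<forall>f\<in>U. \<exists>F \<epsilon>. finite F \<and> F \<subseteq> P \<and> \<epsilon> > 0 \<and> ?nb f F \<epsilon> \<subseteq> U)"
  have "istopology ?L"
    unfolding istopology_def
  proof (intro conjI allI impI)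
    fix S T assume S: "?L S" and T: "?L T"
    show "S \<inter> T \<subseteq> V" using S by blast
    show "\<forall>f\<in>S \<inter> T. \<exists>F \<epsilon>. finite F \<and> F \<subseteq> P \<and> \<epsilon> > 0 \<and> ?nb f F \<epsilon> \<subseteq> S \<inter> T"
    proof
      fix f assume f: "f \<in> S \<inter> T"
      obtain F d where F: "finite F" "F \<subseteq> P" "d > 0" "?nb f F d \<subseteq> S"
        using bspec[OF conjunct2[OF S] IntD1[OF f]] by (elim exE conjE) (rule that)
      obtain G e where G: "finite G" "G \<subseteq> P" "e > 0" "?nb f G e \<subseteq> T"
        using bspec[OF conjunct2[OF T] IntD2[OF f]] by (elim exE conjE) (rule that)
      have "?nb f (F \<union> G) (min d e) \<subseteq> ?nb f F d \<inter> ?nb f G e"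
        by auto
      also have "\<dots> \<subseteq> S \<inter> T"
        by (rule Int_mono[OF F(4) G(4)])
      finally have "?nb f (F \<union> G) (min d e) \<subseteq> S \<inter> T" .
      moreover have "finite (F \<union> G)" "F \<union> G \<subseteq> P" "min d e > 0"
        using F G by auto
      ultimately show "\<exists>F \<epsilon>. finite F \<and> F \<subseteq> P \<and> \<epsilon> > 0 \<and> ?nb f F \<epsilon> \<subseteq> S \<inter> T"
        by (intro exI conjI)
    qed
  next
    fix \<K> assume K: "\<forall>K\<in>\<K>. ?L K"
    show "\<Union>\<K> \<subseteq> V" using K by blast
    show "\<forall>f\<in>\<Union>\<K>. \<exists>F \<epsilon>. finite F \<and> F \<subseteq> P \<and> \<epsilon> > 0 \<and> ?nb f F \<epsilon> \<subseteq> \<Union>\<K>"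
    proof
      fix f assume "f \<in> \<Union>\<K>"
      then obtain K where K': "K \<in> \<K>" "f \<in> K" by (rule UnionE)
      obtain F e where F: "finite F" "F \<subseteq> P" "e > 0" "?nb f F e \<subseteq> K"
        using bspec[OF conjunct2[OF bspec[OF K K'(1)]] K'(2)] by (elim exE conjE) (rule that)
      have "?nb f F e \<subseteq> \<Union>\<K>"
        by (rule order_trans[OF F(4) Union_upper[OF K'(1)]])
      with F(1-3) show "\<exists>F \<epsilon>. finite F \<and> F \<subseteq> P \<and> \<epsilon> > 0 \<and> ?nb f F \<epsilon> \<subseteq> \<Union>\<K>"
        by (intro exI conjI)
    qed
  qed
  then show ?thesis
    unfolding seminorm_topology_def by simp
qed

lemma topspace_seminorm_topology [simp]: "topspace (seminorm_topology V P) = V"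
proof
  show "topspace (seminorm_topology V P) \<subseteq> V"
    using openin_topspace[of "seminorm_topology V P"] unfolding openin_seminorm_topology by (rule conjunct1)
  have "openin (seminorm_topology V P) V"
    unfolding openin_seminorm_topology by (auto intro!: exI[of _ "{}"] exI[of _ 1])
  then show "V \<subseteq> topspace (seminorm_topology V P)"
    by (rule openin_subset)
qed


section \<open>Spectra of continuous linear operators\<close>

definition continuous_operators ::
    "('x \<Rightarrow> complex) topology \<Rightarrow> (('x \<Rightarrow> complex) \<Rightarrow> 'x \<Rightarrow> complex) set" where
  "continuous_operators E =
     {T. T \<in> topspace E \<rightarrow> topspace E \<and>
         (\<forall>f\<in>topspace E. \<forall>g\<in>topspace E. T (\<lambda>x. f x + g x) = (\<lambda>x. T f x + T g x)) \<and>
         (\<forall>c. \<forall>f\<in>topspace E. T (\<lambda>x. c * f x) = (\<lambda>x. c * T f x)) \<and>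
         continuous_map E E T}"

definition equicontinuous_operators ::
    "('x \<Rightarrow> complex) topology \<Rightarrow> (('x \<Rightarrow> complex) \<Rightarrow> 'x \<Rightarrow> complex) set \<Rightarrow> bool" where
  "equicontinuous_operators E H \<longleftrightarrow> H \<subseteq> continuous_operators E \<and>
     (\<forall>U. openin E U \<and> (\<lambda>x. 0) \<in> U \<longrightarrow>
        (\<exists>W. openin E W \<and> (\<lambda>x. 0) \<in> W \<and> (\<forall>T\<in>H. T ` W \<subseteq> U)))"

definition shifted ::
    "complex \<Rightarrow> (('x \<Rightarrow> complex) \<Rightarrow> 'x \<Rightarrow> complex) \<Rightarrow> ('x \<Rightarrow> complex) \<Rightarrow> 'x \<Rightarrow> complex" where
  "shifted z T = (\<lambda>f x. z * f x - T f x)"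

definition resolvent ::
    "('x \<Rightarrow> complex) topology \<Rightarrow> complex \<Rightarrow> (('x \<Rightarrow> complex) \<Rightarrow> 'x \<Rightarrow> complex)
       \<Rightarrow> ('x \<Rightarrow> complex) \<Rightarrow> 'x \<Rightarrow> complex" where
  "resolvent E z T = inv_into (topspace E) (shifted z T)"

definition resolvent_set ::
    "('x \<Rightarrow> complex) topology \<Rightarrow> (('x \<Rightarrow> complex) \<Rightarrow> 'x \<Rightarrow> complex) \<Rightarrow> complex set" where
  "resolvent_set E T =
     {z. bij_betw (shifted z T) (topspace E) (topspace E) \<and>
         resolvent E z T \<in> continuous_operators E}"

definition spectrum ::
    "('x \<Rightarrow> complex) topology \<Rightarrow> (('x \<Rightarrow> complex) \<Rightarrow> 'x \<Rightarrow> complex) \<Rightarrow> complex set" where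
  "spectrum E T = - resolvent_set E T"

definition point_spectrum ::
    "('x \<Rightarrow> complex) topology \<Rightarrow> (('x \<Rightarrow> complex) \<Rightarrow> 'x \<Rightarrow> complex) \<Rightarrow> complex set" where
  "point_spectrum E T = {z. \<not> inj_on (shifted z T) (topspace E)}"

definition resolvent_set_star ::
    "('x \<Rightarrow> complex) topology \<Rightarrow> (('x \<Rightarrow> complex) \<Rightarrow> 'x \<Rightarrow> complex) \<Rightarrow> complex set" where
  "resolvent_set_star E T =
     {z. \<exists>\<delta>>0. ball z \<delta> \<subseteq> resolvent_set E T \<and>
         equicontinuous_operators E ((\<lambda>w. resolvent E w T) ` ball z \<delta>)}"

definition spectrum_star ::
    "('x \<Rightarrow> complex) topology \<Rightarrow> (('x \<Rightarrow> complex) \<Rightarrow> 'x \<Rightarrow> complex) \<Rightarrow> complex set" where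
  "spectrum_star E T = - resolvent_set_star E T"


section \<open>Smooth functions on the real line\<close>

definition nth_deriv :: "nat \<Rightarrow> (real \<Rightarrow> complex) \<Rightarrow> real \<Rightarrow> complex" where
  "nth_deriv i f = ((\<lambda>g x. vector_derivative g (at x)) ^^ i) f"

definition C_k :: "nat \<Rightarrow> (real \<Rightarrow> complex) set" where
  "C_k k = {f. (\<forall>i<k. \<forall>x. nth_deriv i f differentiable (at x)) \<and>
               continuous_on UNIV (nth_deriv k f)}"

definition C_infinity :: "(real \<Rightarrow> complex) set" where
  "C_infinity = (\<Inter>k. C_k k)"


section \<open>The Schwartz space\<close>

definition schwartz_norm :: "nat \<Rightarrow> (real \<Rightarrow> complex) \<Rightarrow> ennreal" where
  "schwartz_norm n f =
     (SUP x. SUP i\<in>{..n}. ennreal ((1 + x\<^sup>2) ^ n * cmod (nth_deriv i f x)))"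

definition Schwartz :: "(real \<Rightarrow> complex) set" where
  "Schwartz = {f \<in> C_infinity. \<forall>n. schwartz_norm n f < \<infinity>}"

definition Schwartz_topology :: "(real \<Rightarrow> complex) topology" where
  "Schwartz_topology = seminorm_topology Schwartz (range (\<lambda>n f. enn2real (schwartz_norm n f)))"

lemma topspace_Schwartz_topology [simp]: "topspace Schwartz_topology = Schwartz"
  by (simp add: Schwartz_topology_def)


section \<open>The multiplier space of the Schwartz space\<close>

definition growth_norm :: "nat \<Rightarrow> nat \<Rightarrow> (real \<Rightarrow> complex) \<Rightarrow> ennreal" where
  "growth_norm m n f =
     (SUP x. SUP i\<in>{..m}. ennreal (cmod (nth_deriv i f x) / (1 + x\<^sup>2) ^ n))"

definition O_M :: "(real \<Rightarrow> complex) set" where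
  "O_M = {f \<in> C_infinity. \<forall>m. \<exists>n. growth_norm m n f < \<infinity>}"

definition O_step :: "nat \<Rightarrow> nat \<Rightarrow> (real \<Rightarrow> complex) set" where
  "O_step m n = {f \<in> C_k m. growth_norm m n f < \<infinity>}"

definition O_ind :: "nat \<Rightarrow> (real \<Rightarrow> complex) set" where
  "O_ind m = (\<Union>n. O_step m n)"

text \<open>
  The locally convex inductive limit over \<open>n\<close> of the normed spaces \<^term>\<open>O_step m n\<close>: its
  continuous seminorms are the seminorms on the union whose restriction to every step is
  continuous, i.e. dominated by a multiple of the norm of that step.
\<close>

definition O_ind_topology :: "nat \<Rightarrow> (real \<Rightarrow> complex) topology" where
  "O_ind_topology m =
     seminorm_topology (O_ind m)
       {q. seminorm_on (O_ind m) q \<and>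
           (\<forall>n. \<exists>C. \<forall>f\<in>O_step m n. q f \<le> C * enn2real (growth_norm m n f))}"

text \<open>
  The projective limit over \<open>m\<close>: the coarsest topology on \<^term>\<open>O_M\<close>, which is the intersection
  of the spaces \<^term>\<open>O_ind m\<close>, making all inclusions into these spaces continuous.
\<close>

definition O_M_topology :: "(real \<Rightarrow> complex) topology" where
  "O_M_topology = topology_generated_by {U \<inter> O_M | m U. openin (O_ind_topology m) U}"

lemma O_M_eq_Inter_O_ind: "O_M = (\<Inter>m. O_ind m)"
  by (auto simp: O_M_def O_ind_def O_step_def C_infinity_def)

lemma topspace_O_M_topology [simp]: "topspace O_M_topology = O_M"
proof -
  have "O_ind 0 \<inter> O_M \<in> {U \<inter> O_M | m U. openin (O_ind_topology m) U}"
    using openin_topspace[of "O_ind_topology 0"] by (auto simp: O_ind_topology_def)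
  moreover have "O_ind 0 \<inter> O_M = O_M"
    by (auto simp: O_M_eq_Inter_O_ind)
  ultimately show ?thesis
    unfolding O_M_topology_def by auto
qed

definition multiplication :: "(real \<Rightarrow> complex) \<Rightarrow> (real \<Rightarrow> complex) \<Rightarrow> real \<Rightarrow> complex" where
  "multiplication h f = (\<lambda>x. h x * f x)"

end

theory Submission
  imports Defs
begin

text \<open>
  Call a family of smooth functions uniformly moderate if, for each \<open>m\<close>, the derivatives up to
  order \<open>m\<close> of all its members are bounded by one multiple of one power of \<open>1 + x\<^sup>2\<close>. By the Leibniz
  rule multiplication by such a family is equicontinuous, both on the Schwartz space and on its
  multiplier space. If \<open>z\<close> has positive distance from the range of \<open>h\<close>, then so has a disc around
  \<open>z\<close>, and the functions \<open>1 / (w - h)\<close>, \<open>w\<close> in the disc, are uniformly moderate because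
  \<open>(1 / (w - h))' = h' / (w - h)\<^sup>2\<close>; hence \<open>z\<close> lies in \<open>\<rho>\<^sup>*\<close>. If \<open>z = h x\<close>, all functions in the range of
  \<open>z - M_h\<close> vanish at \<open>x\<close>, whereas a bump function around \<open>x\<close> does not, so \<open>z\<close> is spectral; as \<open>\<rho>\<^sup>*\<close>
  consists of interior points of \<open>\<rho>\<close>, this also determines \<open>\<sigma>\<^sup>*\<close>. Bump functions supported where
  \<open>h = z\<close> are eigenfunctions, and an eigenfunction is nonzero only on the level set.
\<close>

section \<open>Calculus of repeated derivatives\<close>

lemma nth_deriv_0 [simp]: "nth_deriv 0 f = f"
  by (simp add: nth_deriv_def)

text \<open>The definition adds derivatives on the outside. Peeling off the innermost one instead
  lets inductions on the order replace \<open>f\<close> by \<open>f'\<close>.\<close>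

lemma nth_deriv_Suc:
  assumes "\<And>x. (f has_vector_derivative f' x) (at x)"
  shows "nth_deriv (Suc i) f = nth_deriv i f'"
proof -
  have "(\<lambda>x. vector_derivative f (at x)) = f'"
    using assms by (auto intro: vector_derivative_at)
  then show ?thesis
    by (simp add: nth_deriv_def funpow_Suc_right del: funpow.simps)
qed

lemma C_k_0: "f \<in> C_k 0 \<longleftrightarrow> continuous_on UNIV f"
  by (simp add: C_k_def)

text \<open>With \<open>C_k_SucE\<close> this gives the recursive view of the classes: membership in
  \<open>C_k (Suc k)\<close> means having a derivative in \<open>C_k k\<close>. The inductions on
  \<open>k\<close> below run on it.\<close>

lemma C_k_SucI:
  assumes "\<And>x. (f has_vector_derivative f' x) (at x)" and "f' \<in> C_k k"
  shows "f \<in> C_k (Suc k)"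
proof -
  have "nth_deriv i f differentiable (at x)" if "i < Suc k" for i x
  proof (cases i)
    case 0
    then show ?thesis
      using assms(1) by (auto intro: differentiableI_vector)
  next
    case (Suc j)
    then show ?thesis
      using assms(2) that by (simp add: nth_deriv_Suc[OF assms(1)] C_k_def)
  qed
  then show ?thesis
    using assms(2) by (simp add: nth_deriv_Suc[OF assms(1)] C_k_def)
qed

lemma C_k_SucE:
  assumes "f \<in> C_k (Suc k)"
  obtains f' where "\<And>x. (f has_vector_derivative f' x) (at x)" "f' \<in> C_k k"
proof -
  define f' where "f' = (\<lambda>x. vector_derivative f (at x))"
  have "\<forall>x. nth_deriv 0 f differentiable (at x)"
    using assms unfolding C_k_def by blast
  then have D: "(f has_vector_derivative f' x) (at x)" for x
    by (simp add: f'_def vector_derivative_works)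
  have "nth_deriv i f' differentiable (at x)" if "i < k" for i x
  proof -
    have "nth_deriv (Suc i) f differentiable (at x)"
      using assms that unfolding C_k_def by blast
    then show ?thesis
      by (simp add: nth_deriv_Suc[OF D])
  qed
  moreover have "continuous_on UNIV (nth_deriv k f')"
    using assms by (simp add: C_k_def nth_deriv_Suc[OF D])
  ultimately show ?thesis
    using D by (intro that[of f']) (auto simp: C_k_def)
qed

lemma C_k_SucD: "f \<in> C_k (Suc k) \<Longrightarrow> f \<in> C_k k"
proof (induction k arbitrary: f)
  case 0
  then obtain f' where "\<And>x. (f has_vector_derivative f' x) (at x)"
    by (rule C_k_SucE) blast
  then show ?case
    unfolding C_k_0 by (auto intro!: continuous_at_imp_continuous_on has_vector_derivative_continuous)
next
  case (Suc k)
  from Suc.prems obtain f' where "\<And>x. (f has_vector_derivative f' x) (at x)" "f' \<in> C_k (Suc k)"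
    by (rule C_k_SucE) blast
  then show ?case
    by (rule C_k_SucI[OF _ Suc.IH])
qed

lemma C_k_antimono: "k \<le> l \<Longrightarrow> C_k l \<subseteq> C_k k"
  by (induction l rule: dec_induct) (auto dest: C_k_SucD)

lemma C_k_imp_continuous: "f \<in> C_k k \<Longrightarrow> continuous_on UNIV f"
  using C_k_antimono[of 0 k] C_k_0 by auto

lemma C_k_const: "(\<lambda>x. c) \<in> C_k k"
proof (induction k arbitrary: c)
  case (Suc k)
  show ?case
    by (rule C_k_SucI[where f' = "\<lambda>x. 0"]) (auto intro: Suc)
qed (simp add: C_k_0)

lemma C_k_add:
  assumes "f \<in> C_k k" "g \<in> C_k k"
  shows "(\<lambda>x. f x + g x) \<in> C_k k"
    and "i \<le> k \<Longrightarrow> nth_deriv i (\<lambda>x. f x + g x) x = nth_deriv i f x + nth_deriv i g x"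
proof -
  have "(\<lambda>x. f x + g x) \<in> C_k k \<and>
    (\<forall>i\<le>k. nth_deriv i (\<lambda>x. f x + g x) x = nth_deriv i f x + nth_deriv i g x)"
    using assms
  proof (induction k arbitrary: f g)
    case 0
    then show ?case
      by (auto simp: C_k_0 intro: continuous_intros)
  next
    case (Suc k)
    obtain f' where f': "\<And>x. (f has_vector_derivative f' x) (at x)" "f' \<in> C_k k"
      using Suc.prems(1) by (rule C_k_SucE) blast
    obtain g' where g': "\<And>x. (g has_vector_derivative g' x) (at x)" "g' \<in> C_k k"
      using Suc.prems(2) by (rule C_k_SucE) blast
    have D: "((\<lambda>x. f x + g x) has_vector_derivative f' x + g' x) (at x)" for x
      by (intro has_vector_derivative_add f' g')
    note IH = Suc.IH[OF f'(2) g'(2)]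
    have "nth_deriv i (\<lambda>x. f x + g x) x = nth_deriv i f x + nth_deriv i g x" if "i \<le> Suc k" for i
      using IH that by (cases i) (auto simp: nth_deriv_Suc[OF f'(1)] nth_deriv_Suc[OF g'(1)] nth_deriv_Suc[OF D])
    moreover have "(\<lambda>x. f x + g x) \<in> C_k (Suc k)"
      using IH by (intro C_k_SucI[OF D]) simp
    ultimately show ?case
      by simp
  qed
  then show "(\<lambda>x. f x + g x) \<in> C_k k"
    and "i \<le> k \<Longrightarrow> nth_deriv i (\<lambda>x. f x + g x) x = nth_deriv i f x + nth_deriv i g x"
    by auto
qed

lemma C_k_mult:
  assumes "f \<in> C_k k" "g \<in> C_k k"
  shows "(\<lambda>x. f x * g x) \<in> C_k k"
  using assms
proof (induction k arbitrary: f g)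
  case 0
  then show ?case
    by (auto simp: C_k_0 intro: continuous_intros)
next
  case (Suc k)
  obtain f' where f': "\<And>x. (f has_vector_derivative f' x) (at x)" "f' \<in> C_k k"
    using Suc.prems(1) by (rule C_k_SucE) blast
  obtain g' where g': "\<And>x. (g has_vector_derivative g' x) (at x)" "g' \<in> C_k k"
    using Suc.prems(2) by (rule C_k_SucE) blast
  have "((\<lambda>x. f x * g x) has_vector_derivative f x * g' x + f' x * g x) (at x)" for x
    by (intro has_vector_derivative_mult f' g')
  moreover have "(\<lambda>x. f x * g' x + f' x * g x) \<in> C_k k"
    using f' g' Suc.prems by (intro C_k_add Suc.IH) (auto intro: C_k_SucD)
  ultimately show ?case
    by (rule C_k_SucI)
qed

text \<open>A crude Leibniz bound: each differentiation turns a product into two, hence the factor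
  \<open>2 ^ k\<close> in place of binomial sums. All bounds are taken at one point
  \<open>x\<close>, so that \<open>A\<close> and \<open>B\<close> may later depend on
  \<open>x\<close> through weights.\<close>

lemma nth_deriv_mult_le:
  assumes "f \<in> C_k k" "g \<in> C_k k"
    and "\<And>j. j \<le> k \<Longrightarrow> cmod (nth_deriv j f x) \<le> A"
    and "\<And>j. j \<le> k \<Longrightarrow> cmod (nth_deriv j g x) \<le> B"
    and "i \<le> k"
  shows "cmod (nth_deriv i (\<lambda>x. f x * g x) x) \<le> 2 ^ k * (A * B)"
  using assms
proof (induction k arbitrary: f g i)
  case 0
  have "cmod (f x) \<le> A" "cmod (g x) \<le> B"
    using 0(3)[of 0] 0(4)[of 0] by auto
  then show ?case
    using 0(5) by (auto simp: norm_mult intro!: mult_mono order_trans[OF norm_ge_zero])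
next
  case (Suc k)
  have A: "cmod (f x) \<le> A" "0 \<le> A" and B: "cmod (g x) \<le> B" "0 \<le> B"
    using Suc.prems(3)[of 0] Suc.prems(4)[of 0] by (auto intro: order_trans[OF norm_ge_zero])
  obtain f' where f': "\<And>x. (f has_vector_derivative f' x) (at x)" "f' \<in> C_k k"
    using Suc.prems(1) by (rule C_k_SucE) blast
  obtain g' where g': "\<And>x. (g has_vector_derivative g' x) (at x)" "g' \<in> C_k k"
    using Suc.prems(2) by (rule C_k_SucE) blast
  have D: "((\<lambda>x. f x * g x) has_vector_derivative f x * g' x + f' x * g x) (at x)" for x
    by (intro has_vector_derivative_mult f' g')
  have f'b: "cmod (nth_deriv j f' x) \<le> A" if "j \<le> k" for j
    using Suc.prems(3)[of "Suc j"] that by (simp add: nth_deriv_Suc[OF f'(1)])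
  have g'b: "cmod (nth_deriv j g' x) \<le> B" if "j \<le> k" for j
    using Suc.prems(4)[of "Suc j"] that by (simp add: nth_deriv_Suc[OF g'(1)])
  note fC = C_k_SucD[OF Suc.prems(1)] and gC = C_k_SucD[OF Suc.prems(2)]
  show ?case
  proof (cases i)
    case 0
    have "cmod (f x * g x) \<le> A * B"
      using A B by (auto simp: norm_mult intro!: mult_mono)
    also have "\<dots> \<le> 2 ^ Suc k * (A * B)"
      using mult_right_mono[OF one_le_power[of "2::real" "Suc k"], of "A * B"] A B by simp
    finally show ?thesis
      using 0 by simp
  next
    case (Suc j)
    then have j: "j \<le> k"
      using Suc.prems by simp
    have "cmod (nth_deriv j (\<lambda>x. f x * g' x + f' x * g x) x)
      \<le> cmod (nth_deriv j (\<lambda>x. f x * g' x) x) + cmod (nth_deriv j (\<lambda>x. f' x * g x) x)"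
      using f' g' fC gC by (subst C_k_add(2)[OF _ _ j]) (auto intro: C_k_mult norm_triangle_ineq)
    also have "\<dots> \<le> 2 ^ k * (A * B) + 2 ^ k * (A * B)"
      using Suc.prems(3,4)
      by (intro add_mono Suc.IH f'(2) g'(2) fC gC f'b g'b j) auto
    also have "\<dots> = 2 ^ Suc k * (A * B)"
      by simp
    finally show ?thesis
      unfolding Suc nth_deriv_Suc[OF D] .
  qed
qed

lemma nth_deriv_cmult:
  assumes "f \<in> C_k k" "i \<le> k"
  shows "nth_deriv i (\<lambda>x. c * f x) x = c * nth_deriv i f x"
  using assms
proof (induction k arbitrary: f i)
  case (Suc k)
  obtain f' where f': "\<And>x. (f has_vector_derivative f' x) (at x)" "f' \<in> C_k k"
    using Suc.prems(1) by (rule C_k_SucE) blast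
  have D: "((\<lambda>x. c * f x) has_vector_derivative c * f' x) (at x)" for x
    by (intro has_vector_derivative_mult_right f')
  show ?case
    using Suc.prems(2) by (cases i) (auto simp: nth_deriv_Suc[OF f'(1)] nth_deriv_Suc[OF D] Suc.IH[OF f'(2)])
qed simp

section \<open>Smooth functions and their closure properties\<close>

lemma C_infinity_iff: "f \<in> C_infinity \<longleftrightarrow> (\<forall>k. f \<in> C_k k)"
  by (simp add: C_infinity_def)

lemma C_infinity_continuous: "f \<in> C_infinity \<Longrightarrow> continuous_on UNIV f"
  by (auto simp: C_infinity_iff intro: C_k_imp_continuous)

lemma C_infinity_add: "f \<in> C_infinity \<Longrightarrow> g \<in> C_infinity \<Longrightarrow> (\<lambda>x. f x + g x) \<in> C_infinity"
  by (simp add: C_infinity_iff C_k_add)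

lemma C_infinity_mult: "f \<in> C_infinity \<Longrightarrow> g \<in> C_infinity \<Longrightarrow> (\<lambda>x. f x * g x) \<in> C_infinity"
  by (simp add: C_infinity_iff C_k_mult)

lemma C_infinity_derivE:
  assumes "f \<in> C_infinity"
  obtains f' where "\<And>x. (f has_vector_derivative f' x) (at x)" "f' \<in> C_infinity"
proof -
  have "f \<in> C_k (Suc k)" for k
    using assms by (simp add: C_infinity_iff)
  \<comment> \<open>\<open>C_k_SucE\<close> yields a derivative for each \<open>k\<close>
    separately; uniqueness of derivatives identifies them, so that a single function lies in every
    \<open>C_k k\<close>.\<close>
  then have "\<exists>f'. (\<forall>x. (f has_vector_derivative f' x) (at x)) \<and> f' \<in> C_k k" for k
    by (meson C_k_SucE)
  then obtain F where F: "\<And>k x. (f has_vector_derivative F k x) (at x)" "\<And>k. F k \<in> C_k k"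
    by metis
  then have "F k = F 0" for k
    by (intro ext vector_derivative_unique_at[OF F(1) F(1)])
  then show ?thesis
    using F that[of "F 0"] by (metis C_infinity_iff)
qed

lemma C_infinity_cmult: "f \<in> C_infinity \<Longrightarrow> (\<lambda>x. c * f x) \<in> C_infinity"
  by (simp add: C_infinity_iff C_k_mult[OF C_k_const])

text \<open>Supplies the translates and reflections from which bumps are built. By the chain rule a
  differentiation only adds the constant factor \<open>a\<close>.\<close>

lemma C_infinity_affine:
  assumes "f \<in> C_infinity"
  shows "(\<lambda>x. f (a * x + b)) \<in> C_infinity"
proof -
  have "(\<lambda>x. f (a * x + b)) \<in> C_k k" if "f \<in> C_k k" for f k
    using that
  proof (induction k arbitrary: f)
    case 0
    then have "continuous_on UNIV (f \<circ> (\<lambda>x. a * x + b))"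
      unfolding C_k_0 by (intro continuous_on_compose[of UNIV "\<lambda>x. a * x + b"] continuous_intros)
        (auto intro: continuous_on_subset)
    then show ?case
      by (simp add: C_k_0 o_def)
  next
    case (Suc k)
    from Suc.prems obtain f' where f': "\<And>x. (f has_vector_derivative f' x) (at x)" "f' \<in> C_k k"
      by (rule C_k_SucE) blast
    have "((\<lambda>x. f (a * x + b)) has_vector_derivative of_real a * f' (a * x + b)) (at x)" for x
    proof -
      have "((\<lambda>x. a * x + b) has_vector_derivative a) (at x)"
        unfolding has_real_derivative_iff_has_vector_derivative[symmetric]
        by (auto intro!: derivative_eq_intros)
      from vector_diff_chain_at[OF this f'(1)] show ?thesis
        by (simp add: o_def scaleR_conv_of_real)
    qed
    then show ?case
      by (rule C_k_SucI) (rule C_k_mult[OF C_k_const Suc.IH[OF f'(2)], of "of_real a"])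
  qed
  with assms show ?thesis
    by (simp add: C_infinity_iff)
qed

text \<open>Near each point of the open set \<open>S\<close> the function coincides with the
  constant 0, so \<open>f'\<close> vanishes on \<open>S\<close> too and the induction continues with
  the same \<open>S\<close>.\<close>

lemma nth_deriv_eq_0_on_open:
  assumes "f \<in> C_infinity" "open S" "\<And>x. x \<in> S \<Longrightarrow> f x = 0" "x \<in> S"
  shows "nth_deriv i f x = 0"
  using assms
proof (induction i arbitrary: f)
  case (Suc i)
  from Suc.prems(1) obtain f'
    where f': "\<And>x. (f has_vector_derivative f' x) (at x)" "f' \<in> C_infinity"
    by (rule C_infinity_derivE) blast
  have "f' y = 0" if "y \<in> S" for y
  proof -
    have "((\<lambda>x. 0) has_vector_derivative f' y) (at y)"
      by (rule has_vector_derivative_transform_within_open[OF f'(1) Suc.prems(2) that])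
        (rule Suc.prems(3))
    then show ?thesis
      by (rule vector_derivative_unique_at[OF _ has_vector_derivative_const])
  qed
  then show ?case
    using Suc.IH[OF f'(2)] Suc.prems by (simp add: nth_deriv_Suc[OF f'(1)])
qed auto

section \<open>Bump functions\<close>

text \<open>The factor \<open>inverse x ^ k\<close> makes this family closed, up to linear combinations, under
  differentiation.\<close>

definition exp_inv :: "nat \<Rightarrow> real \<Rightarrow> real" where
  "exp_inv k x = (if x > 0 then exp (- inverse x) * inverse x ^ k else 0)"

text \<open>Substituting \<open>inverse x\<close> turns the limit from the right into the decay of
  \<open>x ^ k / exp x\<close> at infinity.\<close>

lemma exp_inv_tendsto_0: "(exp_inv k \<longlongrightarrow> 0) (at 0)"
proof (rule filterlim_split_at)
  show "(exp_inv k \<longlongrightarrow> 0) (at_left 0)"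
    by (rule tendsto_eventually) (auto simp: exp_inv_def eventually_at_left_field intro: exI[of _ "-1"])
  have "((\<lambda>x::real. x ^ k / exp x) \<longlongrightarrow> 0) at_top"
    by (rule tendsto_power_div_exp_0)
  then have "((\<lambda>x::real. inverse x ^ k / exp (inverse x)) \<longlongrightarrow> 0) (at_right 0)"
    by (rule filterlim_compose) (rule filterlim_inverse_at_top_right)
  moreover have "eventually (\<lambda>x::real. inverse x ^ k / exp (inverse x) = exp_inv k x) (at_right 0)"
    by (auto simp: eventually_at_right_field exp_inv_def exp_minus field_simps intro: exI[of _ 1])
  ultimately show "(exp_inv k \<longlongrightarrow> 0) (at_right 0)"
    by (rule Lim_transform_eventually)
qed

lemma exp_inv_has_derivative:
  "(exp_inv k has_real_derivative exp_inv (k + 2) x - real k * exp_inv (k + 1) x) (at x)"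
proof -
  consider "x > 0" | "x = 0" | "x < 0"
    by linarith
  then show ?thesis
  proof cases
    case 1
    \<comment> \<open>The exponent \<open>k - 1\<close> is truncated at 0, but for
      \<open>k = 0\<close> both sides vanish through the factor \<open>real k\<close>.\<close>
    have *: "real k * inverse x ^ (k - 1) * inverse x ^ 2 = real k * inverse x ^ (k + 1)"
      by (cases k) (simp_all add: power2_eq_square)
    have D0: "exp_inv (k + 1) x = exp (- inverse x) * inverse x ^ (k + 1)"
      using 1 by (simp add: exp_inv_def)
    have D1: "real k * exp_inv (k + 1) x = exp (- inverse x) * (real k * inverse x ^ (k - 1) * inverse x ^ 2)"
      unfolding D0 * by (rule mult.left_commute)
    have D2: "exp_inv (k + 2) x = exp (- inverse x) * inverse x ^ 2 * inverse x ^ k"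
      using 1 unfolding exp_inv_def power_add by simp
    have D: "((\<lambda>x. exp (- inverse x) * inverse x ^ k) has_real_derivative
        exp (- inverse x) * inverse x ^ 2 * inverse x ^ k
        - exp (- inverse x) * (real k * inverse x ^ (k - 1) * inverse x ^ 2)) (at x)"
    proof (rule DERIV_cong)
      have i: "(inverse has_real_derivative - (inverse x ^ Suc (Suc 0))) (at x)"
        using 1 by (intro DERIV_inverse) simp
      show "((\<lambda>x. exp (- inverse x) * inverse x ^ k) has_real_derivative
          exp (- inverse x) * (- (- (inverse x ^ Suc (Suc 0)))) * inverse x ^ k
          + real k * (- (inverse x ^ Suc (Suc 0)) * inverse x ^ (k - Suc 0)) * exp (- inverse x)) (at x)"
        by (rule DERIV_mult[OF DERIV_fun_exp[OF DERIV_minus[OF i]] DERIV_power[OF i]])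
    qed (simp only: minus_minus power2_eq_square power_Suc power_0 mult_1_right One_nat_def, algebra)
    have "((\<lambda>x. exp (- inverse x) * inverse x ^ k) has_real_derivative
        exp_inv (k + 2) x - real k * exp_inv (k + 1) x) (at x)"
      unfolding D1 D2 by (rule D)
    then show ?thesis
      by (rule has_field_derivative_transform_within_open[of _ _ _ "{0<..}"])
        (use 1 in \<open>auto simp: exp_inv_def\<close>)
  next
    case 2
    \<comment> \<open>The difference quotient of \<open>exp_inv k\<close> at 0 is
      \<open>exp_inv (Suc k)\<close>, since dividing by \<open>h\<close> adds one factor
      \<open>inverse h\<close>. The claimed derivative is 0 there because every
      \<open>exp_inv\<close> vanishes at 0.\<close>
    have "((\<lambda>h. (exp_inv k (0 + h) - exp_inv k 0) / h) \<longlongrightarrow> 0) (at 0)"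
      by (rule Lim_transform_eventually[OF exp_inv_tendsto_0[of "Suc k"]])
        (auto simp: exp_inv_def eventually_at_filter field_simps)
    then show ?thesis
      using 2 by (simp add: DERIV_def exp_inv_def)
  next
    case 3
    have "((\<lambda>x. 0) has_real_derivative exp_inv (k + 2) x - real k * exp_inv (k + 1) x) (at x)"
      using 3 by (simp add: exp_inv_def)
    then show ?thesis
      by (rule has_field_derivative_transform_within_open[of _ _ _ "{..<0}"])
        (use 3 in \<open>auto simp: exp_inv_def\<close>)
  qed
qed

lemma exp_inv_C_infinity: "(\<lambda>x. complex_of_real (exp_inv k x)) \<in> C_infinity"
proof -
  let ?e = "\<lambda>k x. complex_of_real (exp_inv k x)"
  have "?e k \<in> C_k l" for l
  proof (induction l arbitrary: k)
    case 0
    have "continuous_on UNIV (exp_inv k)"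
      using DERIV_isCont[OF exp_inv_has_derivative] by (simp add: continuous_at_imp_continuous_on)
    then show ?case
      unfolding C_k_0 by (rule continuous_on_of_real)
  next
    case (Suc l)
    \<comment> \<open>The minus sign is moved into a constant factor, so that closure of
      \<open>C_k l\<close> under sums and products applies.\<close>
    have "(?e k has_vector_derivative ?e (k + 2) x + (- of_nat k) * ?e (k + 1) x) (at x)" for x
      using has_vector_derivative_of_real[OF exp_inv_has_derivative[of k x]]
      by simp
    moreover have "(\<lambda>x. (- of_nat k) * ?e (k + 1) x) \<in> C_k l"
      using C_k_const Suc.IH by (rule C_k_mult)
    with Suc.IH have "(\<lambda>x. ?e (k + 2) x + (- of_nat k) * ?e (k + 1) x) \<in> C_k l"
      by (rule C_k_add(1))
    ultimately show ?case
      by (rule C_k_SucI)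
  qed
  then show ?thesis
    by (simp add: C_infinity_iff)
qed

lemma bump_exists:
  assumes "a < b"
  obtains f where "f \<in> C_infinity" "\<And>x. f x \<noteq> 0 \<longleftrightarrow> a < x \<and> x < b"
proof
  \<comment> \<open>The first factor is nonzero exactly to the right of \<open>a\<close>, the
    reflected one exactly to the left of \<open>b\<close>. The arguments are spelled out as
    \<open>1 * x + - a\<close> and \<open>(-1) * x + b\<close> to match
    \<open>C_infinity_affine\<close>.\<close>
  let ?f = "\<lambda>x. complex_of_real (exp_inv 0 (1 * x + - a)) * complex_of_real (exp_inv 0 ((-1) * x + b))"
  show "?f \<in> C_infinity"
    by (rule C_infinity_mult[OF C_infinity_affine[OF exp_inv_C_infinity] C_infinity_affine[OF exp_inv_C_infinity]])
  show "?f x \<noteq> 0 \<longleftrightarrow> a < x \<and> x < b" for x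
    by (auto simp: exp_inv_def)
qed

section \<open>Operators on spaces defined by seminorms\<close>

definition function_subspace :: "('x \<Rightarrow> complex) set \<Rightarrow> bool" where
  "function_subspace V \<longleftrightarrow> (\<lambda>x. 0) \<in> V \<and>
     (\<forall>f\<in>V. \<forall>c. (\<lambda>x. c * f x) \<in> V) \<and> (\<forall>f\<in>V. \<forall>g\<in>V. (\<lambda>x. f x + g x) \<in> V)"

lemma function_subspace_scale: "function_subspace V \<Longrightarrow> f \<in> V \<Longrightarrow> (\<lambda>x. c * f x) \<in> V"
  by (simp add: function_subspace_def)

lemma function_subspace_add:
  "function_subspace V \<Longrightarrow> f \<in> V \<Longrightarrow> g \<in> V \<Longrightarrow> (\<lambda>x. f x + g x) \<in> V"
  by (simp add: function_subspace_def)

lemma function_subspace_diff: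
  assumes "function_subspace V" "f \<in> V" "g \<in> V"
  shows "(\<lambda>x. f x - g x) \<in> V"
  using function_subspace_add[OF assms(1,2) function_subspace_scale[OF assms(1,3), of "-1"]]
  by simp

lemma seminorm_on_triangle:
  "seminorm_on V q \<Longrightarrow> f \<in> V \<Longrightarrow> g \<in> V \<Longrightarrow> q (\<lambda>x. f x + g x) \<le> q f + q g"
  by (simp add: seminorm_on_def)

lemma seminorm_on_scale: "seminorm_on V q \<Longrightarrow> f \<in> V \<Longrightarrow> q (\<lambda>x. c * f x) = cmod c * q f"
  by (simp add: seminorm_on_def)

text \<open>One inequality suffices for homogeneity: the reverse one comes from scaling back by
  \<open>inverse c\<close>, and \<open>c = 0\<close> is settled by nonnegativity.\<close>

lemma seminorm_onI:
  assumes V: "function_subspace V"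
    and nonneg: "\<And>f. f \<in> V \<Longrightarrow> 0 \<le> q f"
    and scale: "\<And>f c. f \<in> V \<Longrightarrow> q (\<lambda>x. c * f x) \<le> cmod c * q f"
    and triangle: "\<And>f g. f \<in> V \<Longrightarrow> g \<in> V \<Longrightarrow> q (\<lambda>x. f x + g x) \<le> q f + q g"
  shows "seminorm_on V q"
proof -
  have "q (\<lambda>x. c * f x) = cmod c * q f" if f: "f \<in> V" for f c
  proof (cases "c = 0")
    case True
    have "(\<lambda>x. c * f x) \<in> V"
      using V f by (simp add: function_subspace_def)
    with True show ?thesis
      using scale[OF f, of 0] nonneg[of "\<lambda>x. 0"] by simp
  next
    case False
    have cf: "(\<lambda>x. c * f x) \<in> V"
      using V f by (simp add: function_subspace_def)
    have "q (\<lambda>x. inverse c * (c * f x)) \<le> cmod (inverse c) * q (\<lambda>x. c * f x)"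
      by (rule scale[OF cf])
    also have "(\<lambda>x. inverse c * (c * f x)) = f"
      using False by auto
    finally have "cmod c * q f \<le> q (\<lambda>x. c * f x)"
      using False by (simp add: norm_divide norm_inverse field_simps)
    with scale[OF f, of c] show ?thesis
      by simp
  qed
  then show ?thesis
    using nonneg triangle by (simp add: seminorm_on_def)
qed

lemma openin_seminorm_ball:
  assumes V: "function_subspace V" and P: "\<And>p. p \<in> P \<Longrightarrow> seminorm_on V p"
    and F: "finite F" "F \<subseteq> P"
  shows "openin (seminorm_topology V P) {f \<in> V. \<forall>p\<in>F. p f < \<epsilon>}"
  unfolding openin_seminorm_topology
proof (intro conjI ballI)
  fix f assume "f \<in> {f \<in> V. \<forall>p\<in>F. p f < \<epsilon>}"
  then have f: "f \<in> V" "\<And>p. p \<in> F \<Longrightarrow> p f < \<epsilon>"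
    by auto
  \<comment> \<open>The least slack \<open>\<epsilon> - p f\<close> over the finitely many
    \<open>p\<close>. The inserted 1 keeps the minimum defined when \<open>F\<close> is
    empty.\<close>
  define d where "d = Min (insert 1 ((\<lambda>p. \<epsilon> - p f) ` F))"
  have d: "d > 0" "\<And>p. p \<in> F \<Longrightarrow> d \<le> \<epsilon> - p f"
    using F(1) f(2) by (auto simp: d_def)
  have "p g < \<epsilon>" if g: "g \<in> V" and p: "p \<in> F" "p (\<lambda>x. g x - f x) < d" for g p
  proof -
    have "seminorm_on V p"
      using P F p by auto
    moreover have "(\<lambda>x. g x - f x) \<in> V"
      by (rule function_subspace_diff[OF V g f(1)])
    ultimately have "p (\<lambda>x. (g x - f x) + f x) \<le> p (\<lambda>x. g x - f x) + p f"
      using f(1) by (rule seminorm_on_triangle)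
    then show ?thesis
      using p d(2)[of p] by simp
  qed
  then show "\<exists>G \<delta>. finite G \<and> G \<subseteq> P \<and> \<delta> > 0 \<and>
      {g \<in> V. \<forall>p\<in>G. p (\<lambda>x. g x - f x) < \<delta>} \<subseteq> {f \<in> V. \<forall>p\<in>F. p f < \<epsilon>}"
    using F d(1) by (intro exI[of _ F] exI[of _ d]) auto
qed auto

text \<open>The bounds are uniform over \<open>H\<close>, so they yield one neighbourhood of 0 for
  all operators. Induction over the finite set \<open>F\<close> passes from a single seminorm to a
  basic neighbourhood, and linearity carries the estimate from 0 to every \<open>f\<close>, which
  gives continuity.\<close>

lemma equicontinuous_seminorm_topology:
  assumes V: "function_subspace V" and P: "\<And>p. p \<in> P \<Longrightarrow> seminorm_on V p"
    and H: "\<And>T. T \<in> H \<Longrightarrow> T \<in> V \<rightarrow> V"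
      "\<And>T f g. T \<in> H \<Longrightarrow> f \<in> V \<Longrightarrow> g \<in> V \<Longrightarrow> T (\<lambda>x. f x + g x) = (\<lambda>x. T f x + T g x)"
      "\<And>T c f. T \<in> H \<Longrightarrow> f \<in> V \<Longrightarrow> T (\<lambda>x. c * f x) = (\<lambda>x. c * T f x)"
    and bound: "\<And>p. p \<in> P \<Longrightarrow> \<exists>q\<in>P. \<exists>C. \<forall>T\<in>H. \<forall>f\<in>V. p (T f) \<le> C * q f"
  shows "equicontinuous_operators (seminorm_topology V P) H"
proof -
  have nbhd: "\<exists>G \<delta>. finite G \<and> G \<subseteq> P \<and> \<delta> > 0 \<and>
      (\<forall>T\<in>H. \<forall>f\<in>V. (\<forall>q\<in>G. q f < \<delta>) \<longrightarrow> (\<forall>p\<in>F. p (T f) < \<epsilon>))"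
    if F: "finite F" "F \<subseteq> P" and "\<epsilon> > 0" for F \<epsilon>
    using F
  proof (induction F rule: finite_induct)
    case empty
    then show ?case
      by (intro exI[of _ "{}"] exI[of _ 1]) auto
  next
    case (insert p F)
    then obtain G \<delta> where G: "finite G" "G \<subseteq> P" "\<delta> > 0"
      "\<forall>T\<in>H. \<forall>f\<in>V. (\<forall>q\<in>G. q f < \<delta>) \<longrightarrow> (\<forall>p\<in>F. p (T f) < \<epsilon>)"
      by auto
    obtain q C where q: "q \<in> P" "\<And>T f. T \<in> H \<Longrightarrow> f \<in> V \<Longrightarrow> p (T f) \<le> C * q f"
      using bound[of p] insert.prems by auto
    \<comment> \<open>Nothing is known about the sign of \<open>C\<close>;
      \<open>\<bar>C\<bar> + 1\<close> is a positive constant above it, which makes the division and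
      the strict inequality valid.\<close>
    define \<eta> where "\<eta> = \<epsilon> / (\<bar>C\<bar> + 1)"
    have \<eta>: "\<eta> > 0"
      using \<open>\<epsilon> > 0\<close> by (simp add: \<eta>_def)
    have "p (T f) < \<epsilon>" if "T \<in> H" "f \<in> V" "q f < \<eta>" for T f
    proof -
      have q0: "0 \<le> q f"
        using P[OF q(1)] that by (auto simp: seminorm_on_def)
      have "p (T f) \<le> C * q f"
        by (rule q(2)[OF that(1,2)])
      also have "\<dots> \<le> (\<bar>C\<bar> + 1) * q f"
        using q0 by (intro mult_right_mono) auto
      also have "\<dots> < (\<bar>C\<bar> + 1) * \<eta>"
        using that(3) by (intro mult_strict_left_mono) auto
      also have "\<dots> = \<epsilon>"
        by (simp add: \<eta>_def)
      finally show ?thesis .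
    qed
    with G q(1) \<eta> show ?case
      by (intro exI[of _ "insert q G"] exI[of _ "min \<delta> \<eta>"]) auto
  qed
  have continuous: "continuous_map (seminorm_topology V P) (seminorm_topology V P) T" if T: "T \<in> H" for T
    unfolding continuous_map_def topspace_seminorm_topology
  proof (intro conjI allI impI)
    show "T \<in> V \<rightarrow> V"
      by (rule H(1)[OF T])
    fix U assume U: "openin (seminorm_topology V P) U"
    show "openin (seminorm_topology V P) {f \<in> V. T f \<in> U}"
      unfolding openin_seminorm_topology
    proof (intro conjI ballI)
      fix f assume "f \<in> {f \<in> V. T f \<in> U}"
      then have f: "f \<in> V" "T f \<in> U"
        by auto
      obtain F \<epsilon> where F: "finite F" "F \<subseteq> P" "\<epsilon> > 0"
        "{g \<in> V. \<forall>p\<in>F. p (\<lambda>x. g x - T f x) < \<epsilon>} \<subseteq> U"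
        using U f(2) unfolding openin_seminorm_topology by blast
      obtain G \<delta> where G: "finite G" "G \<subseteq> P" "\<delta> > 0"
        "\<forall>T\<in>H. \<forall>f\<in>V. (\<forall>q\<in>G. q f < \<delta>) \<longrightarrow> (\<forall>p\<in>F. p (T f) < \<epsilon>)"
        using nbhd[OF F(1-3)] by auto
      have "T g \<in> U" if g: "g \<in> V" "\<forall>q\<in>G. q (\<lambda>x. g x - f x) < \<delta>" for g
      proof -
        \<comment> \<open>Linearity is given for sums and scalar multiples, so the difference is
          written as \<open>g + (-1) * f\<close>.\<close>
        have mf: "(\<lambda>x. (-1) * f x) \<in> V"
          by (rule function_subspace_scale[OF V f(1)])
        have *: "(\<lambda>x. g x - f x) \<in> V"
          by (rule function_subspace_diff[OF V g(1) f(1)])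
        have "T (\<lambda>x. g x + (-1) * f x) = (\<lambda>x. T g x + (-1) * T f x)"
          unfolding H(2)[OF T g(1) mf] H(3)[OF T f(1)] ..
        then have "T (\<lambda>x. g x - f x) = (\<lambda>x. T g x - T f x)"
          by simp
        moreover have "\<forall>p\<in>F. p (T (\<lambda>x. g x - f x)) < \<epsilon>"
          using G(4) T * g(2) by blast
        ultimately have "\<forall>p\<in>F. p (\<lambda>x. T g x - T f x) < \<epsilon>"
          by simp
        moreover have "T g \<in> V"
          using H(1)[OF T] g(1) by blast
        ultimately show ?thesis
          using F(4) by blast
      qed
      then show "\<exists>G \<delta>. finite G \<and> G \<subseteq> P \<and> \<delta> > 0 \<and>
          {g \<in> V. \<forall>p\<in>G. p (\<lambda>x. g x - f x) < \<delta>} \<subseteq> {f \<in> V. T f \<in> U}"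
        using G(1-3) by (intro exI[of _ G] exI[of _ \<delta>]) auto
    qed auto
  qed
  show ?thesis
    unfolding equicontinuous_operators_def
  proof (intro conjI allI impI subsetI)
    fix T assume "T \<in> H"
    then show "T \<in> continuous_operators (seminorm_topology V P)"
      using H continuous by (auto simp: continuous_operators_def)
  next
    fix U assume U: "openin (seminorm_topology V P) U \<and> (\<lambda>x. 0) \<in> U"
    then obtain F \<epsilon> where F: "finite F" "F \<subseteq> P" "\<epsilon> > 0" "{g \<in> V. \<forall>p\<in>F. p g < \<epsilon>} \<subseteq> U"
      unfolding openin_seminorm_topology by fastforce
    obtain G \<delta> where G: "finite G" "G \<subseteq> P" "\<delta> > 0"
      "\<forall>T\<in>H. \<forall>f\<in>V. (\<forall>q\<in>G. q f < \<delta>) \<longrightarrow> (\<forall>p\<in>F. p (T f) < \<epsilon>)"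
      using nbhd[OF F(1-3)] by auto
    let ?W = "{f \<in> V. \<forall>q\<in>G. q f < \<delta>}"
    have "openin (seminorm_topology V P) ?W"
      by (rule openin_seminorm_ball[OF V P G(1,2)])
    moreover have "q (\<lambda>x. 0) < \<delta>" if "q \<in> G" for q
    proof -
      have "seminorm_on V q" "(\<lambda>x. 0) \<in> V"
        using P G that V by (auto simp: function_subspace_def)
      then show ?thesis
        using seminorm_on_scale[of V q "\<lambda>x. 0" 0] G(3) by simp
    qed
    then have "(\<lambda>x. 0) \<in> ?W"
      using V unfolding function_subspace_def by blast
    moreover have "\<forall>T\<in>H. T ` ?W \<subseteq> U"
      using G(4) F(4) H(1) by blast
    ultimately show "\<exists>W. openin (seminorm_topology V P) W \<and> (\<lambda>x. 0) \<in> W \<and> (\<forall>T\<in>H. T ` W \<subseteq> U)"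
      by blast
  qed
qed

text \<open>Equicontinuity looks at operators on the carrier only. This is what is needed for
  \<open>resolvent\<close>, an \<open>inv_into\<close>, which is identified with a multiplication
  operator there.\<close>

lemma equicontinuous_operators_cong:
  assumes H: "equicontinuous_operators E H"
    and eq: "\<And>T. T \<in> H' \<Longrightarrow> \<exists>S\<in>H. \<forall>f\<in>topspace E. T f = S f"
    and E: "function_subspace (topspace E)"
  shows "equicontinuous_operators E H'"
  unfolding equicontinuous_operators_def
proof (intro conjI allI impI subsetI)
  fix T assume "T \<in> H'"
  then obtain S where S: "S \<in> H" "\<And>f. f \<in> topspace E \<Longrightarrow> T f = S f"
    using eq by blast
  have "S \<in> continuous_operators E"
    using H S(1) by (auto simp: equicontinuous_operators_def)
  moreover from this have "continuous_map E E T"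
    using S(2) by (auto simp: continuous_operators_def intro: continuous_map_eq)
  ultimately show "T \<in> continuous_operators E"
    using S(2) E by (auto simp: continuous_operators_def function_subspace_def Pi_iff)
next
  fix U assume "openin E U \<and> (\<lambda>x. 0) \<in> U"
  then obtain W where W: "openin E W" "(\<lambda>x. 0) \<in> W" "\<forall>T\<in>H. T ` W \<subseteq> U"
    using H unfolding equicontinuous_operators_def by blast
  have "T ` W \<subseteq> U" if "T \<in> H'" for T
    using eq[OF that] W(3) openin_subset[OF W(1)] by (auto simp: image_subset_iff)
  with W show "\<exists>W. openin E W \<and> (\<lambda>x. 0) \<in> W \<and> (\<forall>T\<in>H'. T ` W \<subseteq> U)"
    by blast
qed

section \<open>Multiplication by families of moderate growth\<close>

text \<open>A common form of the Schwartz norms, with growing weights, and of the growth norms, with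
  decaying weights, so that the estimates are proved once.\<close>

definition weighted_norm :: "nat \<Rightarrow> (real \<Rightarrow> real) \<Rightarrow> (real \<Rightarrow> complex) \<Rightarrow> ennreal" where
  "weighted_norm m w f = (SUP x. SUP i\<in>{..m}. ennreal (w x * cmod (nth_deriv i f x)))"

lemma schwartz_norm_eq: "schwartz_norm n = weighted_norm n (\<lambda>x. (1 + x\<^sup>2) ^ n)"
  by (simp add: schwartz_norm_def weighted_norm_def fun_eq_iff)

lemma growth_norm_eq: "growth_norm m n = weighted_norm m (\<lambda>x. inverse ((1 + x\<^sup>2) ^ n))"
  by (simp add: growth_norm_def weighted_norm_def fun_eq_iff divide_inverse mult.commute)

lemma weighted_norm_le:
  assumes "\<And>x i. i \<le> m \<Longrightarrow> w x * cmod (nth_deriv i f x) \<le> C" and "0 \<le> C"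
  shows "weighted_norm m w f < \<infinity>" and "enn2real (weighted_norm m w f) \<le> C"
proof -
  have "weighted_norm m w f \<le> ennreal C"
    unfolding weighted_norm_def using assms by (intro SUP_least ennreal_leI) auto
  then show "weighted_norm m w f < \<infinity>" "enn2real (weighted_norm m w f) \<le> C"
    using assms(2) by (auto simp: enn2real_leI intro: le_less_trans)
qed

lemma weighted_norm_bound:
  assumes "weighted_norm m w f < \<infinity>" "i \<le> m"
  shows "w x * cmod (nth_deriv i f x) \<le> enn2real (weighted_norm m w f)"
proof -
  have "ennreal (w x * cmod (nth_deriv i f x)) \<le> weighted_norm m w f"
    unfolding weighted_norm_def using assms(2) by (intro SUP_upper2[of x] SUP_upper2[of i]) auto
  then have "enn2real (ennreal (w x * cmod (nth_deriv i f x))) \<le> enn2real (weighted_norm m w f)"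
    using assms(1) by (intro enn2real_mono) auto
  \<comment> \<open>If the left side is negative, \<open>ennreal\<close> truncates it to 0 and the
    claim reduces to the nonnegativity of \<open>enn2real\<close>.\<close>
  then show ?thesis
    by (cases "0 \<le> w x * cmod (nth_deriv i f x)") (auto intro: order_trans[OF _ enn2real_nonneg])
qed

lemma weighted_norm_scale:
  assumes "f \<in> C_k m" "weighted_norm m w f < \<infinity>"
  shows "weighted_norm m w (\<lambda>x. c * f x) < \<infinity>"
    and "enn2real (weighted_norm m w (\<lambda>x. c * f x)) \<le> cmod c * enn2real (weighted_norm m w f)"
proof -
  have "w x * cmod (nth_deriv i (\<lambda>x. c * f x) x) \<le> cmod c * enn2real (weighted_norm m w f)" if "i \<le> m" for i x
    using mult_left_mono[OF weighted_norm_bound[OF assms(2) that, of x], of "cmod c"]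
    by (simp add: nth_deriv_cmult[OF assms(1) that] norm_mult mult.left_commute)
  from weighted_norm_le[of m w, OF this] show "weighted_norm m w (\<lambda>x. c * f x) < \<infinity>"
    and "enn2real (weighted_norm m w (\<lambda>x. c * f x)) \<le> cmod c * enn2real (weighted_norm m w f)"
    by auto
qed

lemma weighted_norm_add:
  assumes "f \<in> C_k m" "weighted_norm m w f < \<infinity>" "g \<in> C_k m" "weighted_norm m w g < \<infinity>"
    and w: "\<And>x. 0 \<le> w x"
  shows "weighted_norm m w (\<lambda>x. f x + g x) < \<infinity>"
    and "enn2real (weighted_norm m w (\<lambda>x. f x + g x))
      \<le> enn2real (weighted_norm m w f) + enn2real (weighted_norm m w g)"
proof -
  have "w x * cmod (nth_deriv i (\<lambda>x. f x + g x) x)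
      \<le> enn2real (weighted_norm m w f) + enn2real (weighted_norm m w g)" if "i \<le> m" for i x
  proof -
    have "w x * cmod (nth_deriv i (\<lambda>x. f x + g x) x)
        \<le> w x * (cmod (nth_deriv i f x) + cmod (nth_deriv i g x))"
      unfolding C_k_add(2)[OF assms(1,3) that] by (intro mult_left_mono norm_triangle_ineq w)
    also have "\<dots> \<le> enn2real (weighted_norm m w f) + enn2real (weighted_norm m w g)"
      unfolding distrib_left by (intro add_mono weighted_norm_bound assms that)
    finally show ?thesis .
  qed
  from weighted_norm_le[of m w, OF this] show "weighted_norm m w (\<lambda>x. f x + g x) < \<infinity>"
    and "enn2real (weighted_norm m w (\<lambda>x. f x + g x))
      \<le> enn2real (weighted_norm m w f) + enn2real (weighted_norm m w g)"
    by auto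
qed

text \<open>The growth \<open>u\<close> of the multiplier \<open>g\<close> is paid for by the
  weights: control of \<open>f\<close> with weight \<open>v = w * u\<close> gives control of the
  product with weight \<open>w\<close>. The Leibniz bound is applied at each point with
  \<open>A = C * u x\<close> and \<open>B = N / v x\<close>.\<close>

lemma weighted_norm_mult:
  assumes "f \<in> C_k m" "g \<in> C_k m"
    and g: "\<And>x i. i \<le> m \<Longrightarrow> cmod (nth_deriv i g x) \<le> C * u x"
    and f: "\<And>x i. i \<le> m \<Longrightarrow> v x * cmod (nth_deriv i f x) \<le> N"
    and v: "\<And>x. 0 < v x" and w: "\<And>x. 0 \<le> w x" "\<And>x. w x * u x = v x"
    and "0 \<le> C" "0 \<le> N"
  shows "weighted_norm m w (\<lambda>x. g x * f x) < \<infinity>"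
    and "enn2real (weighted_norm m w (\<lambda>x. g x * f x)) \<le> 2 ^ m * C * N"
proof -
  have "w x * cmod (nth_deriv i (\<lambda>x. g x * f x) x) \<le> 2 ^ m * C * N" if "i \<le> m" for i x
  proof -
    have "cmod (nth_deriv j f x) \<le> N / v x" if "j \<le> m" for j
      using f[OF that, of x] v[of x] by (simp add: field_simps)
    then have "w x * cmod (nth_deriv i (\<lambda>x. g x * f x) x) \<le> w x * (2 ^ m * ((C * u x) * (N / v x)))"
      by (intro mult_left_mono nth_deriv_mult_le w assms that)
    also have "\<dots> = 2 ^ m * C * N * ((w x * u x) / v x)"
      by simp
    also have "\<dots> = 2 ^ m * C * N"
      unfolding w(2) using v[of x] by simp
    finally show ?thesis .
  qed
  from weighted_norm_le[of m w, OF this] show "weighted_norm m w (\<lambda>x. g x * f x) < \<infinity>"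
    and "enn2real (weighted_norm m w (\<lambda>x. g x * f x)) \<le> 2 ^ m * C * N"
    using \<open>0 \<le> C\<close> \<open>0 \<le> N\<close> by auto
qed

section \<open>Families of uniformly moderate growth\<close>

definition uniformly_moderate :: "(real \<Rightarrow> complex) set \<Rightarrow> bool" where
  "uniformly_moderate G \<longleftrightarrow> G \<subseteq> C_infinity \<and>
     (\<forall>m. \<exists>n C. 0 \<le> C \<and> (\<forall>g\<in>G. \<forall>i\<le>m. \<forall>x. cmod (nth_deriv i g x) \<le> C * (1 + x\<^sup>2) ^ n))"

lemma uniformly_moderateE:
  assumes "uniformly_moderate G"
  obtains n C where "0 \<le> C"
    "\<And>g i x. g \<in> G \<Longrightarrow> i \<le> m \<Longrightarrow> cmod (nth_deriv i g x) \<le> C * (1 + x\<^sup>2) ^ n"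
proof -
  have "\<exists>n C. 0 \<le> C \<and> (\<forall>g\<in>G. \<forall>i\<le>m. \<forall>x. cmod (nth_deriv i g x) \<le> C * (1 + x\<^sup>2) ^ n)"
    using assms by (simp add: uniformly_moderate_def)
  then obtain n C where "0 \<le> C" and
    *: "\<forall>g\<in>G. \<forall>i\<le>m. \<forall>x. cmod (nth_deriv i g x) \<le> C * (1 + x\<^sup>2) ^ n"
    by (elim exE conjE)
  show ?thesis
    by (rule that[where n = n and C = C]) (simp_all add: * \<open>0 \<le> C\<close>)
qed

lemma one_plus_square_pos: "0 < 1 + x\<^sup>2" for x :: real
  by (intro add_pos_nonneg) auto

text \<open>Lets the results on families cover \<open>h\<close> itself, and turns its finite growth
  norms into pointwise bounds on derivatives.\<close>

lemma uniformly_moderate_singleton: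
  assumes "h \<in> O_M"
  shows "uniformly_moderate {h}"
proof -
  have "\<exists>n C. 0 \<le> C \<and> (\<forall>i\<le>m. \<forall>x. cmod (nth_deriv i h x) \<le> C * (1 + x\<^sup>2) ^ n)" for m
  proof -
    obtain n where n: "growth_norm m n h < \<infinity>"
      using assms by (auto simp: O_M_def)
    have "cmod (nth_deriv i h x) \<le> enn2real (growth_norm m n h) * (1 + x\<^sup>2) ^ n" if "i \<le> m" for i x
      using weighted_norm_bound[OF n[unfolded growth_norm_eq] that, of x] one_plus_square_pos[of x]
      by (simp add: growth_norm_eq field_simps)
    then show ?thesis
      by (intro exI[of _ n] exI[of _ "enn2real (growth_norm m n h)"]) auto
  qed
  then show ?thesis
    using assms by (simp add: uniformly_moderate_def O_M_def)
qed

lemma uniformly_moderate_reciprocal: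
  assumes h: "h \<in> O_M" and "d > 0" and d: "\<And>w x. w \<in> W \<Longrightarrow> d \<le> cmod (w - h x)"
  shows "uniformly_moderate ((\<lambda>w x. inverse (w - h x)) ` W)"
proof -
  let ?r = "\<lambda>w x. inverse (w - h x)"
  have hC: "h \<in> C_infinity"
    using h by (simp add: O_M_def)
  then obtain h' where h': "\<And>x. (h has_vector_derivative h' x) (at x)" "h' \<in> C_infinity"
    by (rule C_infinity_derivE) blast
  have D: "(?r w has_vector_derivative h' x * (?r w x * ?r w x)) (at x)" if "w \<in> W" for w x
  proof -
    have "w - h x \<noteq> 0"
      using d[OF that, of x] \<open>d > 0\<close> by auto
    then have "((\<lambda>z. inverse (w - z)) has_field_derivative ?r w x * ?r w x) (at (h x))"
      by (auto intro!: derivative_eq_intros)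
    from field_vector_diff_chain_at[OF h'(1) this] show ?thesis
      by (simp add: o_def)
  qed
  have rC: "?r w \<in> C_k k" if "w \<in> W" for w k
  proof (induction k)
    case 0
    have "w - h x \<noteq> 0" for x
      using d[OF that, of x] \<open>d > 0\<close> by auto
    then show ?case
      unfolding C_k_0 using C_infinity_continuous[OF hC] by (intro continuous_intros) auto
  next
    case (Suc k)
    have "(\<lambda>x. h' x * (?r w x * ?r w x)) \<in> C_k k"
      using h'(2) Suc.IH by (intro C_k_mult) (auto simp: C_infinity_iff)
    with D[OF that] show ?case
      by (rule C_k_SucI)
  qed
  have bound: "\<exists>n C. 0 \<le> C \<and> (\<forall>w\<in>W. \<forall>i\<le>m. \<forall>x. cmod (nth_deriv i (?r w) x) \<le> C * (1 + x\<^sup>2) ^ n)" for m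
  proof (induction m)
    case 0
    have "cmod (?r w x) \<le> inverse d" if "w \<in> W" for w x
      using d[OF that, of x] \<open>d > 0\<close> by (simp add: norm_inverse norm_divide le_imp_inverse_le divide_inverse)
    then show ?case
      using \<open>d > 0\<close> by (intro exI[of _ 0] exI[of _ "inverse d"]) auto
  next
    case (Suc m)
    then obtain n C where C: "0 \<le> C"
      "\<And>w i x. w \<in> W \<Longrightarrow> i \<le> m \<Longrightarrow> cmod (nth_deriv i (?r w) x) \<le> C * (1 + x\<^sup>2) ^ n"
      by blast
    obtain l A where "0 \<le> A" "\<And>g i x. g \<in> {h} \<Longrightarrow> i \<le> Suc m \<Longrightarrow> cmod (nth_deriv i g x) \<le> A * (1 + x\<^sup>2) ^ l"
      by (rule uniformly_moderateE[OF uniformly_moderate_singleton[OF h], of "Suc m"]) (rule that)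
    then have A: "0 \<le> A" "\<And>i x. i \<le> Suc m \<Longrightarrow> cmod (nth_deriv i h x) \<le> A * (1 + x\<^sup>2) ^ l"
      by simp_all
    have A': "cmod (nth_deriv i h' x) \<le> A * (1 + x\<^sup>2) ^ l" if "i \<le> m" for i x
      using A(2)[of "Suc i"] that by (simp add: nth_deriv_Suc[OF h'(1)])
    \<comment> \<open>The Leibniz bound is used twice: for \<open>?r w x * ?r w x\<close>, then for
      its product with \<open>h'\<close>. The powers multiply to exponent
      \<open>l + (n + n)\<close>, and adding \<open>C\<close> to \<open>B\<close> covers order 0 as
      well.\<close>
    define B where "B = 2 ^ m * (A * (2 ^ m * (C * C)))"
    have "cmod (nth_deriv i (?r w) x) \<le> (C + B) * (1 + x\<^sup>2) ^ (l + (n + n))"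
      if w: "w \<in> W" and i: "i \<le> Suc m" for w i x
    proof (cases i)
      case 0
      have "cmod (?r w x) \<le> C * (1 + x\<^sup>2) ^ n"
        using C(2)[OF w, of 0 x] by simp
      also have "\<dots> \<le> (C + B) * (1 + x\<^sup>2) ^ (l + (n + n))"
        using C(1) A(1) by (intro mult_mono power_increasing) (auto simp: B_def)
      finally show ?thesis
        using 0 by simp
    next
      case (Suc j)
      have j: "j \<le> m"
        using Suc i by simp
      have hk: "h' \<in> C_k m"
        using h'(2) by (simp add: C_infinity_iff)
      have rr: "cmod (nth_deriv i (\<lambda>x. ?r w x * ?r w x) x)
          \<le> 2 ^ m * ((C * (1 + x\<^sup>2) ^ n) * (C * (1 + x\<^sup>2) ^ n))" if "i \<le> m" for i
        by (rule nth_deriv_mult_le[OF rC[OF w] rC[OF w] C(2)[OF w] C(2)[OF w] that])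
      have "cmod (nth_deriv j (\<lambda>x. h' x * (?r w x * ?r w x)) x)
          \<le> 2 ^ m * ((A * (1 + x\<^sup>2) ^ l) * (2 ^ m * ((C * (1 + x\<^sup>2) ^ n) * (C * (1 + x\<^sup>2) ^ n))))"
        by (rule nth_deriv_mult_le[OF hk C_k_mult[OF rC[OF w] rC[OF w]] A' rr j])
      also have "\<dots> = B * (1 + x\<^sup>2) ^ (l + (n + n))"
        by (simp add: B_def power_add)
      also have "\<dots> \<le> (C + B) * (1 + x\<^sup>2) ^ (l + (n + n))"
        using C(1) one_plus_square_pos[of x] by (intro mult_right_mono) auto
      finally show ?thesis
        by (simp add: Suc nth_deriv_Suc[OF D[OF w]])
    qed
    moreover have "0 \<le> C + B"
      using C(1) A(1) by (simp add: B_def)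
    ultimately show ?case
      by blast
  qed
  show ?thesis
    using rC bound by (simp add: uniformly_moderate_def C_infinity_iff image_subset_iff)
qed

section \<open>Multiplication on the Schwartz space\<close>

lemma Schwartz_iff:
  "f \<in> Schwartz \<longleftrightarrow> f \<in> C_infinity \<and> (\<forall>n. weighted_norm n (\<lambda>x. (1 + x\<^sup>2) ^ n) f < \<infinity>)"
  by (simp add: Schwartz_def schwartz_norm_eq)

lemma SchwartzD:
  assumes "f \<in> Schwartz"
  shows "f \<in> C_infinity" "f \<in> C_k k" "weighted_norm n (\<lambda>x. (1 + x\<^sup>2) ^ n) f < \<infinity>"
  using assms unfolding Schwartz_iff C_infinity_iff by blast+

lemma function_subspace_Schwartz: "function_subspace Schwartz"
  unfolding function_subspace_def
proof (intro conjI ballI allI)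
  \<comment> \<open>The derivatives of the zero function vanish by homogeneity with factor
    0.\<close>
  have "weighted_norm n w (\<lambda>x. 0) < \<infinity>" for n w
    by (rule weighted_norm_le(1)[where C = 0])
      (use nth_deriv_cmult[OF C_k_const, of _ n 0 0] in simp_all)
  then show "(\<lambda>x. 0) \<in> Schwartz"
    unfolding Schwartz_iff C_infinity_iff using C_k_const by blast
next
  fix f c assume f: "f \<in> Schwartz"
  show "(\<lambda>x. c * f x) \<in> Schwartz"
    unfolding Schwartz_iff
    using C_infinity_cmult[OF SchwartzD(1)[OF f]] weighted_norm_scale(1)[OF SchwartzD(2,3)[OF f]] by blast
next
  fix f g assume f: "f \<in> Schwartz" and g: "g \<in> Schwartz"
  have "weighted_norm n (\<lambda>x. (1 + x\<^sup>2) ^ n) (\<lambda>x. f x + g x) < \<infinity>" for n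
    by (rule weighted_norm_add(1)[OF SchwartzD(2,3)[OF f] SchwartzD(2,3)[OF g]]) simp
  then show "(\<lambda>x. f x + g x) \<in> Schwartz"
    unfolding Schwartz_iff using C_infinity_add[OF SchwartzD(1)[OF f] SchwartzD(1)[OF g]] by blast
qed

lemma seminorm_on_schwartz_norm: "seminorm_on Schwartz (\<lambda>f. enn2real (schwartz_norm n f))"
proof (rule seminorm_onI[OF function_subspace_Schwartz])
  show "enn2real (schwartz_norm n (\<lambda>x. c * f x)) \<le> cmod c * enn2real (schwartz_norm n f)"
    if "f \<in> Schwartz" for f c
    unfolding schwartz_norm_eq by (rule weighted_norm_scale[OF SchwartzD(2,3)[OF that]])
  show "enn2real (schwartz_norm n (\<lambda>x. f x + g x))
      \<le> enn2real (schwartz_norm n f) + enn2real (schwartz_norm n g)"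
    if f: "f \<in> Schwartz" and g: "g \<in> Schwartz" for f g
    unfolding schwartz_norm_eq
    by (rule weighted_norm_add[OF SchwartzD(2,3)[OF f] SchwartzD(2,3)[OF g]]) simp
qed simp

lemma multiplication_linear:
  "multiplication g (\<lambda>x. f x + f' x) = (\<lambda>x. multiplication g f x + multiplication g f' x)"
  "multiplication g (\<lambda>x. c * f x) = (\<lambda>x. c * multiplication g f x)"
  by (auto simp: multiplication_def algebra_simps)

lemma equicontinuous_multiplication_Schwartz:
  assumes G: "uniformly_moderate G"
  shows "equicontinuous_operators Schwartz_topology (multiplication ` G)"
proof -
  have bound: "\<exists>k C. \<forall>g\<in>G. \<forall>f\<in>Schwartz. schwartz_norm m (multiplication g f) < \<infinity> \<and>
      enn2real (schwartz_norm m (multiplication g f)) \<le> C * enn2real (schwartz_norm k f)" for m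
  proof -
    obtain n C where C: "0 \<le> C"
      "\<And>g i x. g \<in> G \<Longrightarrow> i \<le> m \<Longrightarrow> cmod (nth_deriv i g x) \<le> C * (1 + x\<^sup>2) ^ n"
      by (rule uniformly_moderateE[OF G, of m]) (rule that)
    \<comment> \<open>The norm of index \<open>m + n\<close> carries \<open>m + n\<close> powers of
      the weight: \<open>n\<close> of them absorb the growth of \<open>g\<close>, and
      \<open>m\<close> remain for the norm of the product.\<close>
    have "schwartz_norm m (\<lambda>x. g x * f x) < \<infinity> \<and>
      enn2real (schwartz_norm m (\<lambda>x. g x * f x)) \<le> 2 ^ m * C * enn2real (schwartz_norm (m + n) f)"
      if g: "g \<in> G" and f: "f \<in> Schwartz" for g f
    proof -
      have fin: "weighted_norm (m + n) (\<lambda>x. (1 + x\<^sup>2) ^ (m + n)) f < \<infinity>" and fC: "f \<in> C_k m"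
        using SchwartzD[OF f] by auto
      have gC: "g \<in> C_k m"
        using g G by (auto simp: uniformly_moderate_def C_infinity_iff)
      have bnd: "(1 + x\<^sup>2) ^ (m + n) * cmod (nth_deriv i f x) \<le> enn2real (schwartz_norm (m + n) f)"
        if "i \<le> m" for i x
        using weighted_norm_bound[OF fin, of i x] that by (simp add: schwartz_norm_eq)
      have w: "0 < (1 + x\<^sup>2) ^ (m + n)" "0 \<le> (1 + x\<^sup>2) ^ m"
        "(1 + x\<^sup>2) ^ m * (1 + x\<^sup>2) ^ n = (1 + x\<^sup>2) ^ (m + n)" for x :: real
        using one_plus_square_pos[of x] by (simp_all add: power_add)
      note le = weighted_norm_mult[OF fC gC C(2)[OF g] bnd w C(1) enn2real_nonneg]
      show ?thesis
        unfolding schwartz_norm_eq[of m] by (intro conjI le)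
    qed
    then show ?thesis
      unfolding multiplication_def by blast
  qed
  have "multiplication g \<in> Schwartz \<rightarrow> Schwartz" if "g \<in> G" for g
  proof
    fix f assume f: "f \<in> Schwartz"
    have "multiplication g f \<in> C_infinity"
      unfolding multiplication_def using that f G
      by (intro C_infinity_mult) (auto simp: uniformly_moderate_def Schwartz_def)
    then show "multiplication g f \<in> Schwartz"
      using bound that f by (auto simp: Schwartz_def)
  qed
  moreover have "\<exists>k C. \<forall>g\<in>G. \<forall>f\<in>Schwartz.
      enn2real (schwartz_norm m (multiplication g f)) \<le> C * enn2real (schwartz_norm k f)" for m
    using bound[of m] by blast
  ultimately show ?thesis
    unfolding Schwartz_topology_def
    by (intro equicontinuous_seminorm_topology function_subspace_Schwartz)
      (auto simp: seminorm_on_schwartz_norm multiplication_linear)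
qed

section \<open>Multiplication on the steps and inductive limits behind \<open>O_M\<close>\<close>

lemma O_stepD:
  assumes "f \<in> O_step m n"
  shows "f \<in> C_k m" "weighted_norm m (\<lambda>x. inverse ((1 + x\<^sup>2) ^ n)) f < \<infinity>"
  using assms unfolding O_step_def growth_norm_eq by blast+

text \<open>A higher power only shrinks the weight. Because the steps increase, two elements of
  their union share a step and can be added there.\<close>

lemma O_step_mono:
  assumes "n \<le> n'"
  shows "O_step m n \<subseteq> O_step m n'"
proof
  fix f assume f: "f \<in> O_step m n"
  have "inverse ((1 + x\<^sup>2) ^ n') * cmod (nth_deriv i f x) \<le> enn2real (growth_norm m n f)" if "i \<le> m" for i x
  proof -
    have "inverse ((1 + x\<^sup>2) ^ n') \<le> inverse ((1 + x\<^sup>2) ^ n)"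
      using assms one_plus_square_pos[of x] by (intro le_imp_inverse_le power_increasing) auto
    then have "inverse ((1 + x\<^sup>2) ^ n') * cmod (nth_deriv i f x)
        \<le> inverse ((1 + x\<^sup>2) ^ n) * cmod (nth_deriv i f x)"
      by (rule mult_right_mono) simp
    also have "\<dots> \<le> enn2real (growth_norm m n f)"
      unfolding growth_norm_eq by (rule weighted_norm_bound[OF O_stepD(2)[OF f] that])
    finally show ?thesis .
  qed
  from weighted_norm_le(1)[OF this enn2real_nonneg] show "f \<in> O_step m n'"
    using O_stepD(1)[OF f] unfolding O_step_def growth_norm_eq by blast
qed

lemma O_indE:
  assumes "f \<in> O_ind m"
  obtains n where "f \<in> O_step m n"
  using assms by (auto simp: O_ind_def)

lemma O_indI: "f \<in> O_step m n \<Longrightarrow> f \<in> O_ind m"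
  by (auto simp: O_ind_def)

lemma function_subspace_O_ind: "function_subspace (O_ind m)"
  unfolding function_subspace_def
proof (intro conjI ballI allI)
  have "weighted_norm m w (\<lambda>x. 0) < \<infinity>" for w
    by (rule weighted_norm_le(1)[where C = 0])
      (use nth_deriv_cmult[OF C_k_const, of _ m 0 0] in simp_all)
  then have "(\<lambda>x. 0) \<in> O_step m 0"
    unfolding O_step_def growth_norm_eq using C_k_const by blast
  then show "(\<lambda>x. 0) \<in> O_ind m"
    by (rule O_indI)
next
  fix f c assume "f \<in> O_ind m"
  then obtain n where f: "f \<in> O_step m n"
    by (rule O_indE)
  have "(\<lambda>x. c * f x) \<in> O_step m n"
    unfolding O_step_def growth_norm_eq
    using C_k_mult[OF C_k_const O_stepD(1)[OF f]] weighted_norm_scale(1)[OF O_stepD[OF f]] by blast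
  then show "(\<lambda>x. c * f x) \<in> O_ind m"
    by (rule O_indI)
next
  fix f g assume "f \<in> O_ind m" "g \<in> O_ind m"
  then obtain n k where "f \<in> O_step m n" "g \<in> O_step m k"
    by (auto elim!: O_indE)
  then have f: "f \<in> O_step m (max n k)" and g: "g \<in> O_step m (max n k)"
    using O_step_mono[of n "max n k" m] O_step_mono[of k "max n k" m] by auto
  have "weighted_norm m (\<lambda>x. inverse ((1 + x\<^sup>2) ^ max n k)) (\<lambda>x. f x + g x) < \<infinity>"
    by (rule weighted_norm_add(1)[OF O_stepD[OF f] O_stepD[OF g]]) (simp add: add_nonneg_nonneg)
  then have "(\<lambda>x. f x + g x) \<in> O_step m (max n k)"
    unfolding O_step_def growth_norm_eq using C_k_add(1)[OF O_stepD(1)[OF f] O_stepD(1)[OF g]] by blast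
  then show "(\<lambda>x. f x + g x) \<in> O_ind m"
    by (rule O_indI)
qed

text \<open>The Leibniz bound moves the growth exponent by that of the family. The point is the
  order of quantifiers: the shift \<open>k\<close> and the constant \<open>C\<close> serve all steps
  \<open>n\<close> and all members of \<open>G\<close>.\<close>

lemma multiplication_O_step:
  assumes "uniformly_moderate G"
  obtains k C where "0 \<le> C"
    "\<And>g n f. g \<in> G \<Longrightarrow> f \<in> O_step m n \<Longrightarrow> multiplication g f \<in> O_step m (n + k)"
    "\<And>g n f. g \<in> G \<Longrightarrow> f \<in> O_step m n \<Longrightarrow>
      enn2real (growth_norm m (n + k) (multiplication g f)) \<le> C * enn2real (growth_norm m n f)"
proof -
  obtain k C where C: "0 \<le> C"
    "\<And>g i x. g \<in> G \<Longrightarrow> i \<le> m \<Longrightarrow> cmod (nth_deriv i g x) \<le> C * (1 + x\<^sup>2) ^ k"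
    by (rule uniformly_moderateE[OF assms, of m]) (rule that)
  have *: "multiplication g f \<in> O_step m (n + k) \<and>
      enn2real (growth_norm m (n + k) (multiplication g f)) \<le> 2 ^ m * C * enn2real (growth_norm m n f)"
    if g: "g \<in> G" and f: "f \<in> O_step m n" for g n f
  proof -
    have gC: "g \<in> C_k m"
      using g assms by (auto simp: uniformly_moderate_def C_infinity_iff)
    have bnd: "inverse ((1 + x\<^sup>2) ^ n) * cmod (nth_deriv i f x) \<le> enn2real (growth_norm m n f)"
      if "i \<le> m" for i x
      unfolding growth_norm_eq by (rule weighted_norm_bound[OF O_stepD(2)[OF f] that])
    have w: "0 < inverse ((1 + x\<^sup>2) ^ n)" "0 \<le> inverse ((1 + x\<^sup>2) ^ (n + k))"
      "inverse ((1 + x\<^sup>2) ^ (n + k)) * (1 + x\<^sup>2) ^ k = inverse ((1 + x\<^sup>2) ^ n)" for x :: real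
      using one_plus_square_pos[of x] by (simp_all add: power_add)
    note le = weighted_norm_mult[OF O_stepD(1)[OF f] gC C(2)[OF g] bnd w C(1) enn2real_nonneg]
    show ?thesis
      unfolding O_step_def growth_norm_eq[of m "n + k"] multiplication_def
      by (intro conjI CollectI le C_k_mult gC O_stepD(1)[OF f])
  qed
  show ?thesis
    by (rule that[of "2 ^ m * C" k]) (use C(1) * in auto)
qed

text \<open>A seminorm on the inductive limit that dominates \<open>q (multiplication g f)\<close> uniformly in
  \<open>g \<in> G\<close> is the supremum over \<open>g\<close>; it is continuous because a uniformly moderate family shifts
  the steps of the limit by the same amount.\<close>

lemma equicontinuous_multiplication_O_ind:
  assumes G: "uniformly_moderate G"
  shows "equicontinuous_operators (O_ind_topology m) (multiplication ` G)"
proof (cases "G = {}")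
  case True
  then show ?thesis
    unfolding equicontinuous_operators_def
    by (auto intro: exI[of _ "topspace (O_ind_topology m)"] dest: openin_subset)
next
  \<comment> \<open>A member is needed for the real supremum below: \<open>cSUP_least\<close>
    requires a nonempty index set, and \<open>0 \<le> Q f\<close> is read off from
    \<open>g0\<close>.\<close>
  case False
  then obtain g0 where g0: "g0 \<in> G"
    by blast
  obtain k C where kC: "0 \<le> C"
    "\<And>g n f. g \<in> G \<Longrightarrow> f \<in> O_step m n \<Longrightarrow> multiplication g f \<in> O_step m (n + k)"
    "\<And>g n f. g \<in> G \<Longrightarrow> f \<in> O_step m n \<Longrightarrow>
      enn2real (growth_norm m (n + k) (multiplication g f)) \<le> C * enn2real (growth_norm m n f)"
    by (rule multiplication_O_step[OF G, of m]) (rule that)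
  have maps: "multiplication g f \<in> O_ind m" if "g \<in> G" "f \<in> O_ind m" for g f
    using that kC(2) by (auto elim!: O_indE intro: O_indI)
  let ?P = "{q. seminorm_on (O_ind m) q \<and>
           (\<forall>n. \<exists>C. \<forall>f\<in>O_step m n. q f \<le> C * enn2real (growth_norm m n f))}"
  have sup: "\<exists>Q\<in>?P. \<forall>g\<in>G. \<forall>f\<in>O_ind m. q (multiplication g f) \<le> Q f" if "q \<in> ?P" for q
  proof -
    have q: "seminorm_on (O_ind m) q"
      using that by simp
    have q0: "0 \<le> q f" if "f \<in> O_ind m" for f
      using q that by (simp add: seminorm_on_def)
    have "\<forall>n. \<exists>C. \<forall>f\<in>O_step m n. q f \<le> C * enn2real (growth_norm m n f)"
      using that by simp
    then obtain K where "\<forall>n. \<forall>f\<in>O_step m n. q f \<le> K n * enn2real (growth_norm m n f)"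
      by (rule choice[THEN exE])
    then have K: "q f \<le> K n * enn2real (growth_norm m n f)" if "f \<in> O_step m n" for n f
      using that by blast
    define Q where "Q f = (SUP g\<in>G. q (multiplication g f))" for f
    \<comment> \<open>The chosen constants \<open>K n\<close> may be negative, hence the absolute
      value before the estimates are multiplied.\<close>
    have step: "q (multiplication g f) \<le> \<bar>K (n + k)\<bar> * C * enn2real (growth_norm m n f)"
      if "g \<in> G" "f \<in> O_step m n" for g n f
    proof -
      have "q (multiplication g f) \<le> K (n + k) * enn2real (growth_norm m (n + k) (multiplication g f))"
        by (rule K[OF kC(2)[OF that]])
      also have "\<dots> \<le> \<bar>K (n + k)\<bar> * (C * enn2real (growth_norm m n f))"
        using kC(3)[OF that] by (intro mult_mono) auto
      finally show ?thesis
        by (simp add: mult.assoc)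
    qed
    have bdd: "bdd_above ((\<lambda>g. q (multiplication g f)) ` G)" if f: "f \<in> O_ind m" for f
    proof -
      obtain n where "f \<in> O_step m n"
        by (rule O_indE[OF f])
      with step show ?thesis
        by (auto intro!: bdd_aboveI2)
    qed
    have upper: "q (multiplication g f) \<le> Q f" if "g \<in> G" "f \<in> O_ind m" for g f
      unfolding Q_def by (rule cSUP_upper[OF that(1) bdd[OF that(2)]])
    have least: "Q f \<le> B" if "\<And>g. g \<in> G \<Longrightarrow> q (multiplication g f) \<le> B" for f B
      unfolding Q_def by (rule cSUP_least[OF False that])
    have "seminorm_on (O_ind m) Q"
    proof (rule seminorm_onI[OF function_subspace_O_ind])
      show "0 \<le> Q f" if "f \<in> O_ind m" for f
        using q0[OF maps[OF g0 that]] upper[OF g0 that] by simp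
      show "Q (\<lambda>x. c * f x) \<le> cmod c * Q f" if f: "f \<in> O_ind m" for f c
      proof (rule least)
        fix g assume g: "g \<in> G"
        have "q (multiplication g (\<lambda>x. c * f x)) = cmod c * q (multiplication g f)"
          unfolding multiplication_linear by (rule seminorm_on_scale[OF q maps[OF g f]])
        also have "\<dots> \<le> cmod c * Q f"
          by (intro mult_left_mono upper[OF g f]) simp
        finally show "q (multiplication g (\<lambda>x. c * f x)) \<le> cmod c * Q f" .
      qed
      show "Q (\<lambda>x. f x + f' x) \<le> Q f + Q f'" if f: "f \<in> O_ind m" "f' \<in> O_ind m" for f f'
      proof (rule least)
        fix g assume g: "g \<in> G"
        have "q (multiplication g (\<lambda>x. f x + f' x)) \<le> q (multiplication g f) + q (multiplication g f')"
          unfolding multiplication_linear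
          by (rule seminorm_on_triangle[OF q maps[OF g f(1)] maps[OF g f(2)]])
        also have "\<dots> \<le> Q f + Q f'"
          by (intro add_mono upper g f)
        finally show "q (multiplication g (\<lambda>x. f x + f' x)) \<le> Q f + Q f'" .
      qed
    qed
    moreover have "Q f \<le> \<bar>K (n + k)\<bar> * C * enn2real (growth_norm m n f)" if "f \<in> O_step m n" for n f
      by (rule least) (rule step[OF _ that])
    ultimately show ?thesis
      using upper by (intro bexI[of _ Q]) auto
  qed
  show ?thesis
    unfolding O_ind_topology_def
  proof (rule equicontinuous_seminorm_topology[OF function_subspace_O_ind])
    fix q assume "q \<in> ?P"
    from sup[OF this] obtain Q where "Q \<in> ?P" "\<forall>g\<in>G. \<forall>f\<in>O_ind m. q (multiplication g f) \<le> 1 * Q f"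
      by auto
    then show "\<exists>Q\<in>?P. \<exists>C. \<forall>T\<in>multiplication ` G. \<forall>f\<in>O_ind m. q (T f) \<le> C * Q f"
      by blast
  qed (auto simp: multiplication_linear maps)
qed

text \<open>The same maps act on every \<open>O_ind m\<close>, so the preimage of a generating set
  \<open>U \<inter> O_M\<close> is again the trace of an open set at level \<open>m\<close>. For
  neighbourhoods of 0, equicontinuity at level \<open>m\<close> treats the generating sets, and an
  induction over the generated topology treats intersections and unions.\<close>

lemma equicontinuous_O_M_topology:
  assumes H: "\<And>m. equicontinuous_operators (O_ind_topology m) H"
  shows "equicontinuous_operators O_M_topology H"
proof -
  let ?B = "{U \<inter> O_M | m U. openin (O_ind_topology m) U}"
  have sub: "O_M \<subseteq> O_ind m" for m
    by (auto simp: O_M_eq_Inter_O_ind)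
  have top: "topspace (O_ind_topology m) = O_ind m" for m
    by (simp add: O_ind_topology_def)
  have HD: "T \<in> O_ind m \<rightarrow> O_ind m" "continuous_map (O_ind_topology m) (O_ind_topology m) T"
    "\<And>f g. f \<in> O_ind m \<Longrightarrow> g \<in> O_ind m \<Longrightarrow> T (\<lambda>x. f x + g x) = (\<lambda>x. T f x + T g x)"
    "\<And>c f. f \<in> O_ind m \<Longrightarrow> T (\<lambda>x. c * f x) = (\<lambda>x. c * T f x)" if "T \<in> H" for T m
    using H[of m] that by (auto simp: equicontinuous_operators_def continuous_operators_def top)
  have maps: "T \<in> O_M \<rightarrow> O_M" if "T \<in> H" for T
    using HD(1)[OF that] by (auto simp: O_M_eq_Inter_O_ind Pi_iff)
  have basis: "openin O_M_topology (U \<inter> O_M)" if "openin (O_ind_topology m) U" for m U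
    unfolding O_M_topology_def openin_topology_generated_by_iff
    using that by (intro generate_topology_on.Basis) blast
  have "continuous_map O_M_topology O_M_topology T" if T: "T \<in> H" for T
  proof -
    have "continuous_map O_M_topology (topology_generated_by ?B) T"
    proof (rule continuous_on_generated_topo)
      fix V assume "V \<in> ?B"
      then obtain m U where V: "V = U \<inter> O_M" "openin (O_ind_topology m) U"
        by blast
      have "openin (O_ind_topology m) {f \<in> O_ind m. T f \<in> U}"
        using openin_continuous_map_preimage[OF HD(2)[OF T] V(2)] by (simp add: top)
      then have "openin O_M_topology ({f \<in> O_ind m. T f \<in> U} \<inter> O_M)"
        by (rule basis)
      also have "{f \<in> O_ind m. T f \<in> U} \<inter> O_M = T -` V \<inter> topspace O_M_topology"
        using sub[of m] maps[OF T] V(1) by (auto simp: Pi_iff)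
      finally show "openin O_M_topology (T -` V \<inter> topspace O_M_topology)" .
    next
      have "\<Union>?B = O_M"
        using topspace_O_M_topology unfolding O_M_topology_def by simp
      then show "T ` topspace O_M_topology \<subseteq> \<Union>?B"
        using maps[OF T] by auto
    qed
    then show ?thesis
      by (simp add: O_M_topology_def)
  qed
  then have "H \<subseteq> continuous_operators O_M_topology"
    using maps HD(3,4) sub by (auto simp: continuous_operators_def) blast+
  moreover have "\<exists>W. openin O_M_topology W \<and> (\<lambda>x. 0) \<in> W \<and> (\<forall>T\<in>H. T ` W \<subseteq> U)"
    if "openin O_M_topology U" "(\<lambda>x. 0) \<in> U" for U
  proof -
    have "generate_topology_on ?B U"
      using that(1) by (simp add: O_M_topology_def openin_topology_generated_by_iff)
    then show ?thesis
      using that(2)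
    proof induction
      case Empty
      then show ?case
        by simp
    next
      case (Int a b)
      then obtain V W where "openin O_M_topology V" "(\<lambda>x. 0) \<in> V" "\<forall>T\<in>H. T ` V \<subseteq> a"
        "openin O_M_topology W" "(\<lambda>x. 0) \<in> W" "\<forall>T\<in>H. T ` W \<subseteq> b"
        by blast
      then show ?case
        by (intro exI[of _ "V \<inter> W"]) (auto simp: image_subset_iff)
    next
      case (UN K)
      then obtain k where k: "k \<in> K" "(\<lambda>x. 0) \<in> k"
        by blast
      from UN.IH[OF k] obtain W where "openin O_M_topology W" "(\<lambda>x. 0) \<in> W" "\<forall>T\<in>H. T ` W \<subseteq> k"
        by blast
      with k(1) show ?case
        by (intro exI[of _ W]) (simp, blast)
    next
      case (Basis s)
      then obtain m V where V: "s = V \<inter> O_M" "openin (O_ind_topology m) V" "(\<lambda>x. 0) \<in> V" "(\<lambda>x. 0) \<in> O_M"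
        by blast
      then obtain W where W: "openin (O_ind_topology m) W" "(\<lambda>x. 0) \<in> W" "\<forall>T\<in>H. T ` W \<subseteq> V"
        using H[of m] unfolding equicontinuous_operators_def by blast
      then show ?case
        using basis[OF W(1)] maps V by (intro exI[of _ "W \<inter> O_M"]) (auto simp: image_subset_iff Pi_iff)
    qed
  qed
  ultimately show ?thesis
    unfolding equicontinuous_operators_def by blast
qed

section \<open>Spectra of multiplication operators\<close>

text \<open>Schwartz functions have bounded derivatives, so the exponent 0 works for every
  \<open>m\<close>. The inclusion puts the bumps into both spaces.\<close>

lemma Schwartz_subset_O_M: "Schwartz \<subseteq> O_M"
proof
  fix f assume f: "f \<in> Schwartz"
  have "weighted_norm m (\<lambda>x. inverse ((1 + x\<^sup>2) ^ 0)) f < \<infinity>" for m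
  proof (rule weighted_norm_le(1)[OF _ enn2real_nonneg])
    fix i x assume i: "i \<le> m"
    have "1 * cmod (nth_deriv i f x) \<le> (1 + x\<^sup>2) ^ m * cmod (nth_deriv i f x)"
      by (intro mult_right_mono one_le_power) auto
    also have "\<dots> \<le> enn2real (schwartz_norm m f)"
      unfolding schwartz_norm_eq by (rule weighted_norm_bound[OF SchwartzD(3)[OF f] i])
    finally show "inverse ((1 + x\<^sup>2) ^ 0) * cmod (nth_deriv i f x) \<le> enn2real (schwartz_norm m f)"
      by simp
  qed
  then show "f \<in> O_M"
    unfolding O_M_def growth_norm_eq using SchwartzD(1)[OF f] by blast
qed

text \<open>All derivatives vanish on the open complement of \<open>{a..b}\<close>, and on this
  compact interval the weighted derivatives are continuous, hence bounded.\<close>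

lemma compactly_supported_Schwartz:
  assumes f: "f \<in> C_infinity" and supp: "\<And>x. f x \<noteq> 0 \<Longrightarrow> a < x \<and> x < b"
  shows "f \<in> Schwartz"
proof -
  have zero: "nth_deriv i f x = 0" if "x \<notin> {a..b}" for i x
    by (rule nth_deriv_eq_0_on_open[OF f, of "- {a..b}"]) (use supp that in force)+
  have "weighted_norm n (\<lambda>x. (1 + x\<^sup>2) ^ n) f < \<infinity>" for n
  proof -
    have "\<exists>C. \<forall>x. (1 + x\<^sup>2) ^ n * cmod (nth_deriv i f x) \<le> C" for i
    proof -
      have "f \<in> C_k i"
        using f by (simp add: C_infinity_iff)
      then have "continuous_on {a..b} (nth_deriv i f)"
        by (auto simp: C_k_def intro: continuous_on_subset)
      then have "compact ((\<lambda>x. (1 + x\<^sup>2) ^ n * cmod (nth_deriv i f x)) ` {a..b})"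
        by (intro compact_continuous_image continuous_intros) auto
      then have "bdd_above ((\<lambda>x. (1 + x\<^sup>2) ^ n * cmod (nth_deriv i f x)) ` {a..b})"
        by (intro bounded_imp_bdd_above compact_imp_bounded)
      then obtain C where C: "\<And>x. x \<in> {a..b} \<Longrightarrow> (1 + x\<^sup>2) ^ n * cmod (nth_deriv i f x) \<le> C"
        unfolding bdd_above_def by blast
      have "(1 + x\<^sup>2) ^ n * cmod (nth_deriv i f x) \<le> max C 0" for x
        using C[of x] zero[of x i] by (cases "x \<in> {a..b}") auto
      then show ?thesis
        by blast
    qed
    then obtain C where C: "\<And>i x. (1 + x\<^sup>2) ^ n * cmod (nth_deriv i f x) \<le> C i"
      by metis
    \<comment> \<open>The bounds \<open>C i\<close> depend on the order; the finite sum of their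
      absolute values dominates those up to \<open>n\<close> at once.\<close>
    show ?thesis
    proof (rule weighted_norm_le(1)[where C = "\<Sum>j\<le>n. \<bar>C j\<bar>"])
      fix x i assume "i \<le> n"
      have "(1 + x\<^sup>2) ^ n * cmod (nth_deriv i f x) \<le> \<bar>C i\<bar>"
        using C[where i = i and x = x] by simp
      also have "\<dots> \<le> (\<Sum>j\<le>n. \<bar>C j\<bar>)"
        using \<open>i \<le> n\<close> by (intro member_le_sum) auto
      finally show "(1 + x\<^sup>2) ^ n * cmod (nth_deriv i f x) \<le> (\<Sum>j\<le>n. \<bar>C j\<bar>)" .
    qed (simp add: sum_nonneg)
  qed
  then show ?thesis
    unfolding Schwartz_iff using f by blast
qed

section \<open>The spectral argument, common to both spaces\<close>

lemma shifted_multiplication: "shifted z (multiplication h) f x = (z - h x) * f x"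
  by (simp add: shifted_def multiplication_def algebra_simps)

text \<open>Collects what the spectral argument uses of the two spaces. Their topologies enter only
  through the equicontinuity of multiplication by uniformly moderate families.\<close>

locale multiplication_space =
  fixes E :: "(real \<Rightarrow> complex) topology"
  assumes subspace: "function_subspace (topspace E)"
    and smooth: "topspace E \<subseteq> C_infinity"
    and Schwartz_subset: "Schwartz \<subseteq> topspace E"
    and equicontinuous: "uniformly_moderate G \<Longrightarrow> equicontinuous_operators E (multiplication ` G)"
begin

lemma multiplication_continuous:
  assumes "uniformly_moderate G" "g \<in> G"
  shows "multiplication g \<in> continuous_operators E"
  using equicontinuous[OF assms(1)] assms(2) by (auto simp: equicontinuous_operators_def)

lemma multiplication_in_topspace:
  assumes "uniformly_moderate G" "g \<in> G" "f \<in> topspace E"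
  shows "multiplication g f \<in> topspace E"
  using multiplication_continuous[OF assms(1,2)] assms(3) by (auto simp: continuous_operators_def)

lemma resolvent_set_subset:
  "resolvent_set E (multiplication h) \<subseteq> - range h"
proof
  fix z assume z: "z \<in> resolvent_set E (multiplication h)"
  have "z \<noteq> h x" for x
  proof
    assume zx: "z = h x"
    obtain f where f: "f \<in> C_infinity" "\<And>y. f y \<noteq> 0 \<longleftrightarrow> x - 1 < y \<and> y < x + 1"
      using bump_exists[of "x - 1" "x + 1"] by auto
    then have "f \<in> topspace E"
      using compactly_supported_Schwartz[of f "x - 1" "x + 1"] Schwartz_subset by blast
    then have "f \<in> shifted z (multiplication h) ` topspace E"
      using z by (simp add: resolvent_set_def bij_betw_def)
    then obtain g where "f = shifted z (multiplication h) g"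
      by blast
    then have "f x = 0"
      by (simp add: shifted_multiplication zx)
    then show False
      using f(2)[of x] by simp
  qed
  then show "z \<in> - range h"
    by blast
qed

lemma compl_closure_subset_resolvent_set_star:
  assumes h: "h \<in> O_M"
  shows "- closure (range h) \<subseteq> resolvent_set_star E (multiplication h)"
proof
  fix z assume "z \<in> - closure (range h)"
  then obtain e where e: "e > 0" "\<And>x. e \<le> dist (h x) z"
    by (auto simp: closure_approachable not_less)
  \<comment> \<open>By the triangle inequality each point of the disc of radius \<open>e / 2\<close>
    keeps distance at least \<open>e / 2\<close> from the range of \<open>h\<close>, which is the
    uniform lower bound for the reciprocals.\<close>
  let ?W = "ball z (e / 2)" and ?r = "\<lambda>w x. inverse (w - h x)"
  have dist: "e / 2 \<le> cmod (w - h x)" if "w \<in> ?W" for w x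
  proof -
    have "e \<le> dist w (h x) + dist w z"
      using e(2)[of x] dist_triangle3[of "h x" z w] by linarith
    then show ?thesis
      using that by (simp add: dist_commute) (simp add: dist_norm)
  qed
  have moderate: "uniformly_moderate (?r ` ?W)"
    using e(1) dist by (intro uniformly_moderate_reciprocal[OF h, of "e / 2"]) auto
  have inv: "(w - h x) * ?r w x = 1" if "w \<in> ?W" for w x
  proof -
    have "w - h x \<noteq> 0"
      using dist[OF that, of x] e(1) by auto
    then show ?thesis
      by simp
  qed
  have r: "multiplication (?r w) f \<in> topspace E" if "w \<in> ?W" "f \<in> topspace E" for w f
    using multiplication_in_topspace[OF moderate] that by blast
  have s: "shifted w (multiplication h) f \<in> topspace E" if "f \<in> topspace E" for w f
    unfolding shifted_def
    by (rule function_subspace_diff[OF subspace function_subspace_scale[OF subspace that]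
          multiplication_in_topspace[OF uniformly_moderate_singleton[OF h] _ that]]) simp
  have sr: "shifted w (multiplication h) (multiplication (?r w) f) = f" if "w \<in> ?W" for w f
  proof
    show "shifted w (multiplication h) (multiplication (?r w) f) x = f x" for x
      unfolding shifted_multiplication multiplication_def mult.assoc[symmetric] inv[OF that] by simp
  qed
  have rs: "multiplication (?r w) (shifted w (multiplication h) f) = f" if "w \<in> ?W" for w f
  proof
    have "?r w x * (w - h x) = 1" for x
      using inv[OF that, of x] by (simp only: mult.commute)
    then show "multiplication (?r w) (shifted w (multiplication h) f) x = f x" for x
      unfolding multiplication_def shifted_def right_diff_distrib[symmetric] left_diff_distrib[symmetric]
        mult.assoc[symmetric] by simp
  qed
  have bij: "bij_betw (shifted w (multiplication h)) (topspace E) (topspace E)" if "w \<in> ?W" for w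
    by (rule bij_betw_byWitness[where f' = "multiplication (?r w)"])
      (use r[OF that] s rs[OF that] sr[OF that] in auto)
  have res: "resolvent E w (multiplication h) f = multiplication (?r w) f"
    if "w \<in> ?W" "f \<in> topspace E" for w f
    unfolding resolvent_def using bij[OF that(1)]
    by (intro inv_into_f_eq r that sr) (simp add: bij_betw_def)
  have "equicontinuous_operators E ((\<lambda>w. resolvent E w (multiplication h)) ` ?W)"
  proof (rule equicontinuous_operators_cong[OF equicontinuous[OF moderate] _ subspace])
    fix T assume "T \<in> (\<lambda>w. resolvent E w (multiplication h)) ` ?W"
    then obtain w where "w \<in> ?W" "T = resolvent E w (multiplication h)"
      by blast
    then show "\<exists>S\<in>multiplication ` ?r ` ?W. \<forall>f\<in>topspace E. T f = S f"
      using res by (intro bexI[of _ "multiplication (?r w)"]) auto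
  qed
  \<comment> \<open>Besides bijectivity, \<open>resolvent_set\<close> asks for a continuous
    resolvent; this is contained in the equicontinuity just shown.\<close>
  moreover from this have "?W \<subseteq> resolvent_set E (multiplication h)"
    using bij by (auto simp: resolvent_set_def equicontinuous_operators_def)
  ultimately show "z \<in> resolvent_set_star E (multiplication h)"
    unfolding resolvent_set_star_def using e(1) by (intro CollectI exI[of _ "e / 2"]) simp
qed

lemma resolvent_set_star_multiplication:
  assumes h: "h \<in> O_M"
  shows "resolvent_set_star E (multiplication h) = - closure (range h)"
proof
  show "resolvent_set_star E (multiplication h) \<subseteq> - closure (range h)"
  proof
    fix z assume "z \<in> resolvent_set_star E (multiplication h)"
    then obtain \<delta> where "\<delta> > 0" "ball z \<delta> \<subseteq> resolvent_set E (multiplication h)"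
      by (auto simp: resolvent_set_star_def)
    \<comment> \<open>The disc is an open set missing the range of \<open>h\<close>, so it misses
      the closure of the range as well.\<close>
    then have "z \<in> ball z \<delta>" "open (ball z \<delta>)" "ball z \<delta> \<inter> range h = {}"
      using resolvent_set_subset[of h] by auto
    then show "z \<in> - closure (range h)"
      using open_Int_closure_eq_empty by blast
  qed
qed (rule compl_closure_subset_resolvent_set_star[OF h])

lemma point_spectrum_multiplication:
  "point_spectrum E (multiplication h) = {z. interior (h -` {z}) \<noteq> {}}"
proof (intro equalityI subsetI CollectI)
  fix z assume "z \<in> point_spectrum E (multiplication h)"
  then obtain f g where fg: "f \<in> topspace E" "g \<in> topspace E" "f \<noteq> g"
    "shifted z (multiplication h) f = shifted z (multiplication h) g"
    by (auto simp: point_spectrum_def inj_on_def)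
  \<comment> \<open>Where \<open>f\<close> and \<open>g\<close> differ, equality of their images
    forces \<open>h x = z\<close>; by continuity this set is open, so it lies in the interior of the
    level set.\<close>
  let ?S = "{x. f x \<noteq> g x}"
  have "continuous_on UNIV f" "continuous_on UNIV g"
    using fg smooth by (auto intro: C_infinity_continuous)
  then have "open ?S"
    by (rule open_Collect_neq)
  moreover have "h x = z" if "f x \<noteq> g x" for x
    using fun_cong[OF fg(4), of x] that by (simp add: shifted_multiplication)
  then have "?S \<subseteq> h -` {z}"
    by auto
  ultimately have "?S \<subseteq> interior (h -` {z})"
    by (intro interior_maximal)
  moreover have "?S \<noteq> {}"
    using fg(3) by auto
  ultimately show "interior (h -` {z}) \<noteq> {}"
    by blast
next
  fix z assume "z \<in> {z. interior (h -` {z}) \<noteq> {}}"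
  then obtain x e where e: "e > 0" "ball x e \<subseteq> h -` {z}"
    by (auto simp: mem_interior)
  obtain f where f: "f \<in> C_infinity" "\<And>y. f y \<noteq> 0 \<longleftrightarrow> x - e < y \<and> y < x + e"
    using bump_exists[of "x - e" "x + e"] e(1) by auto
  have "f \<in> topspace E"
    using compactly_supported_Schwartz[of f "x - e" "x + e"] f Schwartz_subset by blast
  moreover have "(\<lambda>x. 0) \<in> topspace E"
    using subspace by (simp add: function_subspace_def)
  moreover have "f \<noteq> (\<lambda>x. 0)"
    using f(2)[of x] e(1) by auto
  moreover have "(z - h y) * f y = 0" for y
  proof (cases "f y = 0")
    case False
    then have "y \<in> ball x e"
      using f(2)[of y] by (auto simp: dist_real_def)
    then show ?thesis
      using e(2) by auto
  qed simp
  then have "shifted z (multiplication h) f = shifted z (multiplication h) (\<lambda>x. 0)"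
    by (simp add: fun_eq_iff shifted_multiplication)
  ultimately show "z \<in> point_spectrum E (multiplication h)"
    unfolding point_spectrum_def inj_on_def by blast
qed

end

section \<open>The Schwartz space and its multiplier space as instances\<close>

lemma multiplication_space_Schwartz: "multiplication_space Schwartz_topology"
proof
  show "topspace Schwartz_topology \<subseteq> C_infinity"
    using SchwartzD(1) by auto
qed (simp_all add: function_subspace_Schwartz equicontinuous_multiplication_Schwartz)

lemma multiplication_space_O_M: "multiplication_space O_M_topology"
proof
  show "function_subspace (topspace O_M_topology)"
    using function_subspace_O_ind by (auto simp: O_M_eq_Inter_O_ind function_subspace_def)
  show "topspace O_M_topology \<subseteq> C_infinity"
    by (auto simp: O_M_def)
qed (use Schwartz_subset_O_M in
    \<open>auto intro: equicontinuous_O_M_topology equicontinuous_multiplication_O_ind\<close>)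

theorem theorem3p5:
  fixes h :: "real \<Rightarrow> complex" and E :: "(real \<Rightarrow> complex) topology"
  assumes "h \<in> O_M"
    and "E = Schwartz_topology \<or> E = O_M_topology"
  shows "multiplication h \<in> continuous_operators E \<and>
    - closure (range h) \<subseteq> resolvent_set E (multiplication h) \<and>
    resolvent_set E (multiplication h) \<subseteq> - range h \<and>
    resolvent_set_star E (multiplication h) = - closure (range h) \<and>
    range h \<subseteq> spectrum E (multiplication h) \<and>
    spectrum E (multiplication h) \<subseteq> closure (range h) \<and>
    spectrum_star E (multiplication h) = closure (range h) \<and>
    point_spectrum E (multiplication h) = {z. interior (h -` {z}) \<noteq> {}} \<and>
    {z. interior (h -` {z}) \<noteq> {}} \<subseteq> range h"
proof -
  interpret multiplication_space E
    using assms(2) multiplication_space_Schwartz multiplication_space_O_M by blast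
  note star = resolvent_set_star_multiplication[OF assms(1)]
  have "resolvent_set_star E (multiplication h) \<subseteq> resolvent_set E (multiplication h)"
    unfolding resolvent_set_star_def by (blast intro: centre_in_ball[THEN iffD2])
  with star have "- closure (range h) \<subseteq> resolvent_set E (multiplication h)"
    by simp
  moreover have "multiplication h \<in> continuous_operators E"
    by (rule multiplication_continuous[OF uniformly_moderate_singleton[OF assms(1)]]) simp
  moreover have "{z. interior (h -` {z}) \<noteq> {}} \<subseteq> range h"
    using interior_subset by fastforce
  ultimately show ?thesis
    using star resolvent_set_subset[of h] point_spectrum_multiplication[of h]
    unfolding spectrum_def spectrum_star_def by blast
qed

end
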